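(* Consider a multi-layer directed network from the ML-ScBM with true numbers $(K_s,K_r)$ of sender and receiver communities, and suppose the null hypothesis $H_0:(K_s,K_r)=(K_{s0},K_{r0})$ holds. Suppose Assumptions 1–4 (stated in the context) hold, and let $\hat R$ be the normalized residual matrix built from the consistent label estimates $\hat g^s,\hat g^r$ returned by the community detection method $\mathcal M$ with inputs $(K_{s0},K_{r0})$. Let $\hat T_n=\sigma_1(\hat R)-2$. Then for every $\epsilon>0$, $\mathbb{P}(\hat T_n<\epsilon)\to1$ as $n\to\infty$.
   Context: ML-ScBM: $n$ nodes, $L\ge1$ layers, adjacency matrices $A^{(\ell)}\in\{0,1\}^{n\times n}$ with zero diagonal; sender labels $g^s\in\{1,\dots,K_s\}^n$, receiver labels $g^r\in\{1,\dots,K_r\}^n$ common to all layers; block matrices $B^{(\ell)}\in[0,1]^{K_s\times K_r}$. Entries $A^{(\ell)}(i,j)$, $i\ne j$, are independent Bernoulli with mean $\Omega^{(\ell)}(i,j)=B^{(\ell)}(g^s(i),g^r(j))$, and $\Omega^{(\ell)}(i,i)=0$. All quantities may depend on $n$; $K_{\max}=\max(K_s,K_r)$. Assumption 1: some $\delta\in(0,1/2)$ satisfies $\delta\le B^{(\ell)}(k,l)\le1-\delta$ for all $k,l,\ell$. Assumption 2: for some $c_0>0$, every sender community has at least $c_0n/K_s$ nodes and every receiver community has at least $c_0n/K_r$ nodes. Assumption 3: $K_{\max}^2L\log n/n\to0$. Assumption 4: the community detection method $\mathcal M$, applied to $\{A^{(\ell)}\}$ with inputs $(K_s,K_r)$,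 returns $\hat g^s,\hat g^r$ with $\mathbb P(\hat g^s=g^s)\to1$ and $\mathbb P(\hat g^r=g^r)\to1$ (equality up to permutation of labels). Construction of the test statistic for candidate $(K_{s0},K_{r0})$: apply $\mathcal M$ with inputs $(K_{s0},K_{r0})$ to get $\hat g^s\in\{1,\dots,K_{s0}\}^n$, $\hat g^r\in\{1,\dots,K_{r0}\}^n$; set $\hat B^{(\ell)}(k,l)=\frac{\sum_{i:\hat g^s(i)=k}\sum_{j:\hat g^r(j)=l}A^{(\ell)}(i,j)}{|\{i:\hat g^s(i)=k\}|\,|\{j:\hat g^r(j)=l\}|}$; $\hat\Omega^{(\ell)}(i,j)=\hat B^{(\ell)}(\hat g^s(i),\hat g^r(j))$ for $i\ne j$ and $\hat\Omega^{(\ell)}(i,i)=0$; $\hat R(i,i)=0$ and for $i\neq j$ \[\hat R(i,j)=\frac{\sum_{\ell}(A^{(\ell)}(i,j)-\hat\Omega^{(\ell)}(i,j))}{\sqrt{(n-1)\sum_\ell\hat\Omega^{(\ell)}(i,j)(1-\hat\Omega^{(\ell)}(i,j))}}.\] $\sigma_1$ is the largest singular value. *)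

theory Defs
  imports "HOL-Probability.Probability"
begin

text \<open>Conventions: nodes are 0..n-1, layers 0..L-1, sender communities 0..Ks-1,
receiver communities 0..Kr-1. A sample of the multi-layer network is a function
x :: nat * nat * nat => bool, with x (l,i,j) = True iff A^(l)(i,j) = 1.\<close>

type_synonym network = "nat \<times> nat \<times> nat \<Rightarrow> bool"

definition adj :: "network \<Rightarrow> nat \<Rightarrow> nat \<Rightarrow> nat \<Rightarrow> real" where
  "adj x l i j = (if x (l, i, j) then 1 else 0)"

definition entries :: "nat \<Rightarrow> nat \<Rightarrow> (nat \<times> nat \<times> nat) set" where
  "entries n L = {(l, i, j). l < L \<and> i < n \<and> j < n \<and> i \<noteq> j}"

definition mlscbm :: "nat \<Rightarrow> nat \<Rightarrow> (nat \<Rightarrow> nat) \<Rightarrow> (nat \<Rightarrow> nat)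
    \<Rightarrow> (nat \<Rightarrow> nat \<Rightarrow> nat \<Rightarrow> real) \<Rightarrow> network pmf" where
  "mlscbm n L gs gr B =
     Pi_pmf (entries n L) False (\<lambda>(l, i, j). bernoulli_pmf (B l (gs i) (gr j)))"

definition labels_equiv :: "nat \<Rightarrow> nat \<Rightarrow> (nat \<Rightarrow> nat) \<Rightarrow> (nat \<Rightarrow> nat) \<Rightarrow> bool" where
  "labels_equiv n K gh g \<longleftrightarrow>
     (\<exists>\<pi>. bij_betw \<pi> {..<K} {..<K} \<and> (\<forall>i<n. gh i = \<pi> (g i)))"

definition Bhat :: "nat \<Rightarrow> network \<Rightarrow> (nat \<Rightarrow> nat) \<Rightarrow> (nat \<Rightarrow> nat)
    \<Rightarrow> nat \<Rightarrow> nat \<Rightarrow> nat \<Rightarrow> real" where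
  "Bhat n x gsh grh l k m =
     (\<Sum>i\<in>{i. i < n \<and> gsh i = k}. \<Sum>j\<in>{j. j < n \<and> grh j = m}. adj x l i j)
     / (real (card {i. i < n \<and> gsh i = k}) * real (card {j. j < n \<and> grh j = m}))"

definition Omegahat :: "nat \<Rightarrow> network \<Rightarrow> (nat \<Rightarrow> nat) \<Rightarrow> (nat \<Rightarrow> nat)
    \<Rightarrow> nat \<Rightarrow> nat \<Rightarrow> nat \<Rightarrow> real" where
  "Omegahat n x gsh grh l i j =
     (if i = j then 0 else Bhat n x gsh grh l (gsh i) (grh j))"

definition Rhat :: "nat \<Rightarrow> nat \<Rightarrow> network \<Rightarrow> (nat \<Rightarrow> nat) \<Rightarrow> (nat \<Rightarrow> nat)
    \<Rightarrow> nat \<Rightarrow> nat \<Rightarrow> real" where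
  "Rhat n L x gsh grh i j =
     (if i = j then 0 else
        (\<Sum>l<L. adj x l i j - Omegahat n x gsh grh l i j)
        / sqrt ((real n - 1) *
             (\<Sum>l<L. Omegahat n x gsh grh l i j * (1 - Omegahat n x gsh grh l i j))))"

text \<open>Largest singular value of an n x n real matrix M (entries M i j, i,j < n),
i.e. max over unit vectors v of the Euclidean norm of M v.\<close>
definition sigma1 :: "nat \<Rightarrow> (nat \<Rightarrow> nat \<Rightarrow> real) \<Rightarrow> real" where
  "sigma1 n M =
     Sup {sqrt (\<Sum>i<n. (\<Sum>j<n. M i j * v j)\<^sup>2) | v. (\<Sum>j<n. (v j)\<^sup>2) = 1}"

end

theory Submission
  imports Defs "HOL-Real_Asymp.Real_Asymp"
begin

text \<open>
  Let \<open>R\<close> be the residual matrix normalized with the true \<open>B\<close> and let \<open>x\<^sub>k\<close> be its rows. The norm of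
  \<open>R\<close> is bounded by a barrier argument in the style of Batson, Spielman and Srivastava: the rank-one
  matrices of the rows are added one at a time to \<open>A\<close>, while a barrier \<open>u\<close> above the spectrum of \<open>A\<close>
  is moved so that the potential \<open>tr (u - A)\<^sup>-\<^sup>1\<close> stays below about \<open>n/2\<close>. By the Sherman--Morrison
  formula a shift of about \<open>1 / (n (1 - 1/2)) = 2/n\<close> per row compensates the expected growth, so a
  barrier started at \<open>u = 2\<close> ends near \<open>2 + 2 = 4\<close>, and the largest singular value is at most
  \<open>2 + o(1)\<close>. Fluctuations of the quadratic forms are controlled by fourth moments; whenever the
  Frobenius norm of the resolvent is too large, an extra shift is made, and the drop of the
  potential that it causes limits the number of these shifts.

  Under exact recovery of the labels, the estimated block means differ from \<open>B\<close> by
  \<open>O(K sqrt (ln n) / n)\<close> by Hoeffding's bound and a union bound, hence the entries of the estimated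
  matrix differ from those of \<open>R\<close> by \<open>o(1/n)\<close> because of Assumption 3.
\<close>

section \<open>Positive semidefinite matrices and resolvents\<close>

text \<open>Why the start is 2: a barrier started at \<open>u\<close> has potential
  \<open>n / u\<close>, the shifts then total about \<open>1 / (1 - 1/u)\<close>, and
  \<open>u + u / (u - 1)\<close> is least at \<open>u = 2\<close>, where it equals 4, the square of
  the claimed edge. No eigenvalues appear. \<open>H\<close> stands for \<open>u - A\<close>, and a
  positive semidefinite \<open>Q\<close> with \<open>H Q = I\<close> certifies that the barrier lies
  above the spectrum. The obstacle is the Frobenius norm of the resolvent, which governs all
  fluctuations. A trace of order \<open>n\<close> alone allows \<open>frob2\<close> to be of order
  \<open>n^2\<close>, and then even one row may fail. With \<open>frob2\<close> at most
  \<open>n K\<close>, Chebyshev's inequality gives a risk of order \<open>K / n\<close> per row, too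
  much for \<open>n\<close> rows; fourth moments give \<open>K^2 / n^2\<close> per row, which sums
  to \<open>K^2 / n\<close>. Hence fourth moments of quadratic forms, eighth moments of the entries,
  and a threshold \<open>K\<close> well below \<open>sqrt n\<close>.\<close>

definition mat_vec :: "nat \<Rightarrow> (nat \<Rightarrow> nat \<Rightarrow> real) \<Rightarrow> (nat \<Rightarrow> real) \<Rightarrow> nat \<Rightarrow> real" where
  "mat_vec n P x i = (\<Sum>j<n. P i j * x j)"

definition quad_form :: "nat \<Rightarrow> (nat \<Rightarrow> nat \<Rightarrow> real) \<Rightarrow> (nat \<Rightarrow> real) \<Rightarrow> real" where
  "quad_form n P x = (\<Sum>i<n. \<Sum>j<n. P i j * x i * x j)"

definition trace_mat :: "nat \<Rightarrow> (nat \<Rightarrow> nat \<Rightarrow> real) \<Rightarrow> real" where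
  "trace_mat n P = (\<Sum>i<n. P i i)"

definition frob2 :: "nat \<Rightarrow> (nat \<Rightarrow> nat \<Rightarrow> real) \<Rightarrow> real" where
  "frob2 n P = (\<Sum>i<n. \<Sum>j<n. (P i j)\<^sup>2)"

definition sym_mat :: "nat \<Rightarrow> (nat \<Rightarrow> nat \<Rightarrow> real) \<Rightarrow> bool" where
  "sym_mat n P \<longleftrightarrow> (\<forall>i<n. \<forall>j<n. P i j = P j i)"

definition psd_mat :: "nat \<Rightarrow> (nat \<Rightarrow> nat \<Rightarrow> real) \<Rightarrow> bool" where
  "psd_mat n P \<longleftrightarrow> sym_mat n P \<and> (\<forall>x. 0 \<le> quad_form n P x)"

definition right_inverse_mat :: "nat \<Rightarrow> (nat \<Rightarrow> nat \<Rightarrow> real) \<Rightarrow> (nat \<Rightarrow> nat \<Rightarrow> real) \<Rightarrow> bool" where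
  "right_inverse_mat n H Q \<longleftrightarrow>
     (\<forall>i<n. \<forall>j<n. (\<Sum>k<n. H i k * Q k j) = (if i = j then 1 else 0))"

lemma quad_form_mat_vec: "quad_form n P x = (\<Sum>i<n. x i * mat_vec n P x i)"
  unfolding quad_form_def mat_vec_def by (simp add: sum_distrib_left mult_ac)

lemma sum_mat_vec_swap:
  assumes "sym_mat n P"
  shows "(\<Sum>i<n. x i * mat_vec n P y i) = (\<Sum>i<n. y i * mat_vec n P x i)"
proof -
  have "(\<Sum>i<n. x i * mat_vec n P y i) = (\<Sum>i<n. \<Sum>j<n. x i * (P i j * y j))"
    by (simp add: mat_vec_def sum_distrib_left)
  also have "\<dots> = (\<Sum>j<n. \<Sum>i<n. x i * (P i j * y j))" by (rule sum.swap)
  also have "\<dots> = (\<Sum>j<n. \<Sum>i<n. y j * (P j i * x i))"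
    using assms by (intro sum.cong refl) (auto simp: sym_mat_def)
  finally show ?thesis by (simp add: mat_vec_def sum_distrib_left)
qed

lemma quad_form_add_scaled:
  assumes "sym_mat n P"
  shows "quad_form n P (\<lambda>i. x i + t * y i) =
    quad_form n P x + 2 * t * (\<Sum>i<n. x i * mat_vec n P y i) + t\<^sup>2 * quad_form n P y"
proof -
  have "mat_vec n P (\<lambda>i. x i + t * y i) i = mat_vec n P x i + t * mat_vec n P y i" for i
    by (simp add: mat_vec_def sum.distrib sum_distrib_left algebra_simps)
  hence "quad_form n P (\<lambda>i. x i + t * y i) =
    quad_form n P x + t * (\<Sum>i<n. x i * mat_vec n P y i)
      + t * (\<Sum>i<n. y i * mat_vec n P x i) + t\<^sup>2 * quad_form n P y"
    by (simp add: quad_form_mat_vec sum.distrib sum_distrib_left algebra_simps power2_eq_square)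
  thus ?thesis using sum_mat_vec_swap[OF assms, of x y] by simp
qed

text \<open>Stated for all signs of \<open>a\<close>, so that Cauchy-Schwarz for semidefinite forms
  and for expectations are both direct instances.\<close>

lemma nonneg_quadratic_discriminant:
  fixes a b c :: real
  assumes "\<And>t. 0 \<le> c + 2 * t * b + t\<^sup>2 * a"
  shows "b\<^sup>2 \<le> a * c"
proof -
  consider "a = 0" | "a > 0" | "a < 0" by linarith
  thus ?thesis
  proof cases
    case 1
    have "b = 0"
    proof (rule ccontr)
      assume "b \<noteq> 0"
      with assms[of "-(c + 1) / (2 * b)"] 1 show False by (simp add: field_simps)
    qed
    with 1 show ?thesis by simp
  next
    case 2
    with assms[of "- b / a"] have "0 \<le> c - b\<^sup>2 / a" by (simp add: field_simps power2_eq_square)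
    with 2 show ?thesis by (simp add: field_simps power2_eq_square)
  next
    case 3
    \<comment> \<open>Large enough for the negative leading term to outweigh
      \<open>c + 2 * t * b\<close>; the final summand keeps \<open>t \<ge> 1\<close>.\<close>
    define t where "t = (\<bar>c\<bar> + 2 * \<bar>b\<bar> + 1) / (- a) + 1"
    have t1: "t \<ge> 1" using 3 by (simp add: t_def divide_simps)
    have "(- a) * (t - 1) = \<bar>c\<bar> + 2 * \<bar>b\<bar> + 1" using 3 by (simp add: t_def)
    hence "(- a) * t > \<bar>c\<bar> + 2 * \<bar>b\<bar>" using 3 by (simp add: algebra_simps)
    hence "(- a) * t * t > (\<bar>c\<bar> + 2 * \<bar>b\<bar>) * t" using t1 by (intro mult_strict_right_mono) auto
    moreover have "\<bar>c\<bar> * 1 \<le> \<bar>c\<bar> * t" using t1 by (intro mult_left_mono) auto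
    moreover have "b * t \<le> \<bar>b\<bar> * t" using t1 by (intro mult_right_mono) auto
    ultimately have False using assms[of t] by (simp add: algebra_simps power2_eq_square)
    thus ?thesis ..
  qed
qed

lemma psd_Cauchy_Schwarz:
  assumes "psd_mat n P"
  shows "(\<Sum>i<n. x i * mat_vec n P y i)\<^sup>2 \<le> quad_form n P y * quad_form n P x"
proof (rule nonneg_quadratic_discriminant)
  fix t
  show "0 \<le> quad_form n P x + 2 * t * (\<Sum>i<n. x i * mat_vec n P y i) + t\<^sup>2 * quad_form n P y"
    using assms quad_form_add_scaled[of n P x t y] unfolding psd_mat_def by metis
qed

lemma psd_diag_nonneg:
  assumes "psd_mat n P" "i < n"
  shows "0 \<le> P i i"
proof -
  have "quad_form n P (\<lambda>j. if j = i then 1 else 0) =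
      (\<Sum>k<n. if k = i then (\<Sum>j<n. if j = i then P k j else 0) else 0)"
    unfolding quad_form_def by (intro sum.cong refl) (auto simp: if_distrib cong: if_cong)
  also have "\<dots> = P i i" using assms(2) by simp
  finally have "quad_form n P (\<lambda>j. if j = i then 1 else 0) = P i i" .
  thus ?thesis using assms(1) unfolding psd_mat_def by metis
qed

lemma psd_trace_nonneg: "psd_mat n P \<Longrightarrow> 0 \<le> trace_mat n P"
  unfolding trace_mat_def by (intro sum_nonneg) (auto intro: psd_diag_nonneg)

lemma frob2_nonneg: "0 \<le> frob2 n P"
  unfolding frob2_def by (intro sum_nonneg) auto

lemma right_inverse_mat_vec:
  assumes "right_inverse_mat n H Q" "i < n"
  shows "mat_vec n H (mat_vec n Q w) i = w i"
proof -
  have "mat_vec n H (mat_vec n Q w) i = (\<Sum>k<n. \<Sum>j<n. H i k * Q k j * w j)"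
    by (simp add: mat_vec_def sum_distrib_left mult.assoc)
  also have "\<dots> = (\<Sum>j<n. (\<Sum>k<n. H i k * Q k j) * w j)"
    by (subst sum.swap) (simp add: sum_distrib_right)
  also have "\<dots> = (\<Sum>j<n. if i = j then w j else 0)"
    using assms by (intro sum.cong) (auto simp: right_inverse_mat_def)
  also have "\<dots> = w i" using assms(2) by simp
  finally show ?thesis .
qed

text \<open>Transposing \<open>H Q = I\<close> exchanges the factors, because both matrices are
  symmetric.\<close>

lemma right_inverse_is_left_inverse:
  assumes "right_inverse_mat n H Q" "sym_mat n H" "sym_mat n Q"
  shows "right_inverse_mat n Q H"
  unfolding right_inverse_mat_def
proof (intro allI impI)
  fix i j assume ij: "i < n" "j < n"
  have "(\<Sum>k<n. Q i k * H k j) = (\<Sum>k<n. H j k * Q k i)"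
    using assms ij by (intro sum.cong) (auto simp: sym_mat_def)
  thus "(\<Sum>k<n. Q i k * H k j) = (if i = j then 1 else 0)"
    using assms(1) ij by (auto simp: right_inverse_mat_def)
qed

text \<open>Both signs of \<open>c\<close> occur: \<open>c \<ge> 0\<close> raises the barrier along
  a coordinate, \<open>c = - (1 / N)\<close> adds a row to the Gram sum. In the second case
  \<open>pos\<close> says that the row does not reach the barrier.\<close>

lemma Sherman_Morrison:
  fixes c :: real
  assumes psd: "psd_mat n Q" and inv: "right_inverse_mat n H Q"
    and pos: "1 + c * quad_form n Q w > 0"
  defines "y \<equiv> mat_vec n Q w"
  defines "\<kappa> \<equiv> c / (1 + c * quad_form n Q w)"
  defines "Q' \<equiv> (\<lambda>i j. Q i j - \<kappa> * y i * y j)"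
  shows "psd_mat n Q'"
    and "right_inverse_mat n (\<lambda>i j. H i j + c * w i * w j) Q'"
    and "trace_mat n Q' = trace_mat n Q - \<kappa> * (\<Sum>i<n. (y i)\<^sup>2)"
proof -
  have sym: "sym_mat n Q" using psd by (simp add: psd_mat_def)
  let ?q = "quad_form n Q w"
  have q: "?q = (\<Sum>i<n. w i * y i)" by (simp add: quad_form_mat_vec y_def)
  have q0: "?q \<ge> 0" using psd by (simp add: psd_mat_def)
  show "psd_mat n Q'"
    unfolding psd_mat_def
  proof (intro conjI allI)
    show "sym_mat n Q'" using sym by (auto simp: sym_mat_def Q'_def)
    fix x
    define a where "a = (\<Sum>i<n. x i * y i)"
    have "quad_form n Q' x = quad_form n Q x - \<kappa> * (\<Sum>i<n. \<Sum>j<n. (x i * y i) * (x j * y j))"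
      by (simp add: quad_form_def Q'_def sum_subtractf sum_distrib_left algebra_simps)
    also have "(\<Sum>i<n. \<Sum>j<n. (x i * y i) * (x j * y j)) = a\<^sup>2"
      by (simp add: a_def power2_eq_square sum_product)
    finally have eq: "quad_form n Q' x = quad_form n Q x - \<kappa> * a\<^sup>2" .
    have cs: "a\<^sup>2 \<le> ?q * quad_form n Q x"
      unfolding a_def y_def by (rule psd_Cauchy_Schwarz[OF psd])
    have x0: "quad_form n Q x \<ge> 0" using psd by (simp add: psd_mat_def)
    \<comment> \<open>For \<open>c \<ge> 0\<close> the subtracted term is controlled by
      Cauchy-Schwarz and \<open>\<kappa> * ?q \<le> 1\<close>; for \<open>c < 0\<close> it can only
      increase the form.\<close>
    show "0 \<le> quad_form n Q' x"
    proof (cases "c \<ge> 0")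
      case True
      hence k: "\<kappa> \<ge> 0" using pos by (simp add: \<kappa>_def)
      have "\<kappa> * ?q \<le> 1" using pos True by (simp add: \<kappa>_def divide_simps)
      hence "\<kappa> * ?q * quad_form n Q x \<le> 1 * quad_form n Q x" using x0 by (rule mult_right_mono)
      moreover have "\<kappa> * a\<^sup>2 \<le> \<kappa> * (?q * quad_form n Q x)" using cs k by (rule mult_left_mono)
      ultimately show ?thesis using eq by (simp add: mult.assoc)
    next
      case False
      hence "\<kappa> \<le> 0" using pos by (simp add: \<kappa>_def divide_simps)
      hence "\<kappa> * a\<^sup>2 \<le> 0" by (simp add: mult_nonpos_nonneg)
      thus ?thesis using eq x0 by simp
    qed
  qed
  show "right_inverse_mat n (\<lambda>i j. H i j + c * w i * w j) Q'"
    unfolding right_inverse_mat_def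
  proof (intro allI impI)
    fix i j assume ij: "i < n" "j < n"
    have Hy: "(\<Sum>k<n. H i k * y k) = w i"
      using right_inverse_mat_vec[OF inv ij(1), of w] by (simp add: y_def mat_vec_def)
    have wQ: "(\<Sum>k<n. w k * Q k j) = y j"
      unfolding y_def mat_vec_def using sym ij(2) by (intro sum.cong) (auto simp: sym_mat_def)
    have HQ: "(\<Sum>k<n. H i k * Q k j) = (if i = j then 1 else 0)"
      using inv ij by (simp add: right_inverse_mat_def)
    have "(\<Sum>k<n. (H i k + c * w i * w k) * Q' k j) =
       (\<Sum>k<n. H i k * Q k j) - \<kappa> * y j * (\<Sum>k<n. H i k * y k)
        + c * w i * (\<Sum>k<n. w k * Q k j) - c * w i * \<kappa> * y j * (\<Sum>k<n. w k * y k)"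
      by (simp add: Q'_def algebra_simps sum.distrib sum_subtractf sum_distrib_left)
    also have "\<dots> = (if i = j then 1 else 0) + w i * y j * (c - \<kappa> * (1 + c * ?q))"
      unfolding Hy wQ q[symmetric] HQ by (simp add: algebra_simps)
    also have "c - \<kappa> * (1 + c * ?q) = 0" using pos by (simp add: \<kappa>_def)
    finally show "(\<Sum>k<n. (H i k + c * w i * w k) * Q' k j) = (if i = j then 1 else 0)" by simp
  qed
  show "trace_mat n Q' = trace_mat n Q - \<kappa> * (\<Sum>i<n. (y i)\<^sup>2)"
    by (simp add: trace_mat_def Q'_def sum_subtractf sum_distrib_left power2_eq_square mult.assoc)
qed

text \<open>Adding \<open>\<delta>\<close> to one diagonal entry at a time is a sequence of rank-one updates.\<close>
lemma shifted_inverse_exists: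
  assumes psd: "psd_mat n Q" and inv: "right_inverse_mat n H Q" and "\<delta> \<ge> 0" and "m \<le> n"
  shows "\<exists>Q'. psd_mat n Q' \<and>
    right_inverse_mat n (\<lambda>i j. H i j + (if i = j \<and> i < m then \<delta> else 0)) Q'"
  using \<open>m \<le> n\<close>
proof (induction m)
  case 0
  show ?case using psd inv by auto
next
  case (Suc m)
  then obtain Q' where Q': "psd_mat n Q'"
    "right_inverse_mat n (\<lambda>i j. H i j + (if i = j \<and> i < m then \<delta> else 0)) Q'" by auto
  define w where "w = (\<lambda>i. if i = m then 1 else 0 :: real)"
  have "1 + \<delta> * quad_form n Q' w > 0"
    using Q'(1) \<open>\<delta> \<ge> 0\<close> by (auto simp: psd_mat_def intro: add_pos_nonneg)
  note SM = Sherman_Morrison(1,2)[OF Q' this]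
  have "(\<lambda>i j. H i j + (if i = j \<and> i < m then \<delta> else 0) + \<delta> * w i * w j) =
    (\<lambda>i j. H i j + (if i = j \<and> i < Suc m then \<delta> else 0))"
    by (auto simp: w_def fun_eq_iff less_Suc_eq)
  with SM show ?case by auto
qed

text \<open>A quantitative form of \<open>d/du tr (u - A)^-1 = - tr (u - A)^-2\<close>: the drop of
  the trace is at least \<open>\<delta>\<close> times the slope at the new barrier. This drop pays
  for the expected growth of the potential in the next row.\<close>

lemma resolvent_shift:
  assumes psd: "psd_mat n Q" and inv: "right_inverse_mat n H Q" and H: "sym_mat n H"
    and \<delta>: "\<delta> \<ge> 0"
  obtains P where "psd_mat n P" "right_inverse_mat n (\<lambda>i j. H i j + (if i = j then \<delta> else 0)) P"
    "trace_mat n P + \<delta> * frob2 n P \<le> trace_mat n Q"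
proof -
  obtain P where P: "psd_mat n P"
      "right_inverse_mat n (\<lambda>i j. H i j + (if i = j \<and> i < n then \<delta> else 0)) P"
    using shifted_inverse_exists[OF psd inv \<delta> order_refl] by blast
  have Pinv: "right_inverse_mat n (\<lambda>i j. H i j + (if i = j then \<delta> else 0)) P"
    using P(2) by (simp add: right_inverse_mat_def cong: conj_cong)
  have symQ: "sym_mat n Q" and symP: "sym_mat n P"
    using psd P by (auto simp: psd_mat_def)
  have QH: "right_inverse_mat n Q H"
    by (rule right_inverse_is_left_inverse[OF inv H symQ])
  \<comment> \<open>Resolvent identity \<open>Q = P + \<delta> Q P\<close>, from
    \<open>Q = Q (H + \<delta>) P\<close> and \<open>Q H = I\<close>.\<close>
  have res: "Q i j = P i j + \<delta> * (\<Sum>k<n. Q i k * P k j)" if ij: "i < n" "j < n" for i j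
  proof -
    let ?H = "\<lambda>i j. H i j + (if i = j then \<delta> else 0)"
    have "Q i j = (\<Sum>k<n. Q i k * (\<Sum>l<n. ?H k l * P l j))"
    proof -
      have "(\<Sum>k<n. Q i k * (\<Sum>l<n. ?H k l * P l j)) = (\<Sum>k<n. if k = j then Q i k else 0)"
        using Pinv ij by (intro sum.cong) (auto simp: right_inverse_mat_def)
      thus ?thesis using ij by simp
    qed
    also have "\<dots> = (\<Sum>k<n. Q i k * ((\<Sum>l<n. H k l * P l j) + \<delta> * P k j))"
    proof (intro sum.cong refl)
      fix k assume "k \<in> {..<n}"
      hence "(\<Sum>l<n. (if k = l then \<delta> else 0) * P l j) = \<delta> * P k j"
        by (simp add: if_distrib[of "\<lambda>z. z * _"] cong: if_cong)
      thus "Q i k * (\<Sum>l<n. ?H k l * P l j) = Q i k * ((\<Sum>l<n. H k l * P l j) + \<delta> * P k j)"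
        by (simp add: distrib_right sum.distrib)
    qed
    also have "\<dots> = (\<Sum>k<n. \<Sum>l<n. Q i k * H k l * P l j) + \<delta> * (\<Sum>k<n. Q i k * P k j)"
      by (simp add: distrib_left sum.distrib sum_distrib_left mult_ac)
    also have "(\<Sum>k<n. \<Sum>l<n. Q i k * H k l * P l j) = (\<Sum>l<n. (\<Sum>k<n. Q i k * H k l) * P l j)"
      by (subst sum.swap) (simp add: sum_distrib_right)
    also have "\<dots> = (\<Sum>l<n. if i = l then P l j else 0)"
      using QH ij by (intro sum.cong) (auto simp: right_inverse_mat_def)
    also have "\<dots> = P i j" using ij by simp
    finally show ?thesis .
  qed
  have tr: "trace_mat n Q = trace_mat n P + \<delta> * (\<Sum>i<n. \<Sum>k<n. Q i k * P k i)"
    by (simp add: trace_mat_def res sum.distrib sum_distrib_left)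
  \<comment> \<open>The identity once more turns \<open>tr (Q P)\<close> into
    \<open>frob2 n P\<close> plus \<open>\<delta> tr (P Q P)\<close>, and the latter trace is a sum
    of values of the form of \<open>Q\<close>, hence nonnegative.\<close>
  have "(\<Sum>i<n. \<Sum>k<n. Q i k * P k i) =
      (\<Sum>i<n. \<Sum>k<n. (P i k)\<^sup>2 + \<delta> * (\<Sum>l<n. Q i l * P l k * P i k))"
  proof (intro sum.cong refl)
    fix i k assume ik: "i \<in> {..<n}" "k \<in> {..<n}"
    hence "P k i = P i k" using symP by (auto simp: sym_mat_def)
    thus "Q i k * P k i = (P i k)\<^sup>2 + \<delta> * (\<Sum>l<n. Q i l * P l k * P i k)"
      using ik by (simp add: res[of i k] distrib_right power2_eq_square sum_distrib_right mult.assoc)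
  qed
  also have "\<dots> = frob2 n P + \<delta> * (\<Sum>i<n. \<Sum>k<n. \<Sum>l<n. Q i l * P l k * P i k)"
    by (simp add: frob2_def sum.distrib sum_distrib_left)
  also have "(\<Sum>i<n. \<Sum>k<n. \<Sum>l<n. Q i l * P l k * P i k) = (\<Sum>k<n. quad_form n Q (\<lambda>i. P i k))"
    by (subst sum.swap) (simp add: quad_form_def mult_ac)
  finally have "(\<Sum>i<n. \<Sum>k<n. Q i k * P k i) = frob2 n P + \<delta> * (\<Sum>k<n. quad_form n Q (\<lambda>i. P i k))" .
  moreover have "0 \<le> \<delta> * (\<Sum>k<n. quad_form n Q (\<lambda>i. P i k))"
    using psd \<delta> by (intro mult_nonneg_nonneg sum_nonneg) (auto simp: psd_mat_def)
  ultimately have "frob2 n P \<le> (\<Sum>i<n. \<Sum>k<n. Q i k * P k i)" by simp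
  hence "\<delta> * frob2 n P \<le> \<delta> * (\<Sum>i<n. \<Sum>k<n. Q i k * P k i)" using \<delta> by (rule mult_left_mono)
  with tr have "trace_mat n P + \<delta> * frob2 n P \<le> trace_mat n Q" by simp
  with that P(1) Pinv show ?thesis by blast
qed

text \<open>With \<open>z = H x\<close> one has \<open>x = Q z\<close>, so the form of
  \<open>H\<close> at \<open>x\<close> is the form of \<open>Q\<close> at \<open>z\<close>. This is
  how the certificate is cashed in after the last row.\<close>

lemma quad_form_nonneg_of_psd_inverse:
  assumes psd: "psd_mat n Q" and inv: "right_inverse_mat n H Q" and H: "sym_mat n H"
  shows "0 \<le> quad_form n H x"
proof -
  have symQ: "sym_mat n Q" using psd by (simp add: psd_mat_def)
  note QH = right_inverse_is_left_inverse[OF inv H symQ]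
  define z where "z = mat_vec n H x"
  have x: "mat_vec n Q z i = x i" if "i < n" for i
    unfolding z_def by (rule right_inverse_mat_vec[OF QH that])
  have "quad_form n Q z = (\<Sum>i<n. z i * x i)" by (simp add: quad_form_mat_vec x)
  also have "\<dots> = quad_form n H x" by (simp add: quad_form_mat_vec z_def mult.commute)
  finally show ?thesis using psd by (metis psd_mat_def)
qed

text \<open>\<open>P^T P\<close>; for a symmetric resolvent this is \<open>P^2\<close>, the matrix
  in the Sherman-Morrison growth of the trace. In this form it is symmetric and semidefinite for
  every \<open>P\<close>.\<close>

definition gram_mat :: "nat \<Rightarrow> (nat \<Rightarrow> nat \<Rightarrow> real) \<Rightarrow> nat \<Rightarrow> nat \<Rightarrow> real" where
  "gram_mat n P i j = (\<Sum>k<n. P k i * P k j)"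

lemma sum_mat_vec_squares: "(\<Sum>i<n. (mat_vec n P w i)\<^sup>2) = quad_form n (gram_mat n P) w"
proof -
  have "quad_form n (gram_mat n P) w = (\<Sum>i<n. \<Sum>j<n. \<Sum>k<n. (P k i * w i) * (P k j * w j))"
    unfolding quad_form_def gram_mat_def sum_distrib_right by (intro sum.cong refl) (simp add: mult_ac)
  also have "\<dots> = (\<Sum>i<n. \<Sum>k<n. \<Sum>j<n. (P k i * w i) * (P k j * w j))"
    by (rule sum.cong[OF refl], rule sum.swap)
  also have "\<dots> = (\<Sum>k<n. \<Sum>i<n. \<Sum>j<n. (P k i * w i) * (P k j * w j))" by (rule sum.swap)
  also have "\<dots> = (\<Sum>k<n. (mat_vec n P w k)\<^sup>2)"
    by (simp add: mat_vec_def power2_eq_square sum_product)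
  finally show ?thesis by simp
qed

lemma sym_gram_mat: "sym_mat n (gram_mat n P)"
  by (simp add: sym_mat_def gram_mat_def mult.commute)

lemma psd_gram_mat: "psd_mat n (gram_mat n P)"
  unfolding psd_mat_def sum_mat_vec_squares[symmetric] by (auto simp: sym_gram_mat intro!: sum_nonneg)

lemma trace_gram_mat: "trace_mat n (gram_mat n P) = frob2 n P"
  unfolding trace_mat_def gram_mat_def frob2_def power2_eq_square by (rule sum.swap)

text \<open>Cauchy-Schwarz on each entry. It bounds the fluctuations of the form of
  \<open>P^2\<close> by the same quantity \<open>frob2 n P\<close> as those of the form of
  \<open>P\<close>.\<close>

lemma frob2_gram_mat: "frob2 n (gram_mat n P) \<le> (frob2 n P)\<^sup>2"
proof -
  have "(gram_mat n P i j)\<^sup>2 \<le> (\<Sum>k<n. (P k i)\<^sup>2) * (\<Sum>k<n. (P k j)\<^sup>2)" for i j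
    unfolding gram_mat_def by (rule Cauchy_Schwarz_ineq_sum)
  hence "frob2 n (gram_mat n P) \<le> (\<Sum>i<n. \<Sum>j<n. (\<Sum>k<n. (P k i)\<^sup>2) * (\<Sum>k<n. (P k j)\<^sup>2))"
    unfolding frob2_def by (intro sum_mono)
  also have "\<dots> = (\<Sum>i<n. \<Sum>k<n. (P k i)\<^sup>2)\<^sup>2" by (simp add: sum_product power2_eq_square)
  also have "(\<Sum>i<n. \<Sum>k<n. (P k i)\<^sup>2) = frob2 n P" unfolding frob2_def by (rule sum.swap)
  finally show ?thesis .
qed

section \<open>Fourth moments of quadratic forms\<close>

lemma finite_set_Pi_pmf:
  "finite A \<Longrightarrow> (\<And>x. x \<in> A \<Longrightarrow> finite (set_pmf (p x))) \<Longrightarrow> finite (set_pmf (Pi_pmf A d p))"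
  by (simp add: set_Pi_pmf finite_PiE_dflt)

lemma expectation_bind_finite:
  fixes h :: "_ \<Rightarrow> real"
  assumes "finite (set_pmf p)" "\<And>x. x \<in> set_pmf p \<Longrightarrow> finite (set_pmf (f x))"
  shows "measure_pmf.expectation (bind_pmf p f) h =
    measure_pmf.expectation p (\<lambda>x. measure_pmf.expectation (f x) h)"
  using assms by (subst pmf_expectation_bind[of "set_pmf p"], auto)
    (subst integral_measure_pmf[of "set_pmf p"], auto)

text \<open>Two orders of integration. The first fixes the new coordinate and averages over the
  others, as when a row is revealed before the later rows; the second averages the new coordinate
  with the others frozen, as in a martingale step.\<close>

lemma expectation_Pi_pmf_insert:
  fixes h :: "_ \<Rightarrow> real"
  assumes "finite A" "a \<notin> A" "\<And>x. x \<in> insert a A \<Longrightarrow> finite (set_pmf (p x))"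
  shows "measure_pmf.expectation (Pi_pmf (insert a A) d p) h =
      measure_pmf.expectation (p a) (\<lambda>y. measure_pmf.expectation (Pi_pmf A d p) (\<lambda>f. h (f(a := y))))"
    and "measure_pmf.expectation (Pi_pmf (insert a A) d p) h =
      measure_pmf.expectation (Pi_pmf A d p) (\<lambda>f. measure_pmf.expectation (p a) (\<lambda>y. h (f(a := y))))"
proof -
  have fin: "finite (set_pmf (Pi_pmf A d p))" "finite (set_pmf (p a))"
    using assms by (auto intro!: finite_set_Pi_pmf)
  have "Pi_pmf (insert a A) d p = p a \<bind> (\<lambda>y. map_pmf (\<lambda>f. f(a := y)) (Pi_pmf A d p))"
    using assms by (simp add: Pi_pmf_insert' map_pmf_def)
  thus "measure_pmf.expectation (Pi_pmf (insert a A) d p) h =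
      measure_pmf.expectation (p a) (\<lambda>y. measure_pmf.expectation (Pi_pmf A d p) (\<lambda>f. h (f(a := y))))"
    using fin by (simp add: expectation_bind_finite)
  have "Pi_pmf (insert a A) d p = Pi_pmf A d p \<bind> (\<lambda>f. map_pmf (\<lambda>y. f(a := y)) (p a))"
    using assms by (subst Pi_pmf_insert', simp, simp, subst bind_commute_pmf) (simp add: map_pmf_def)
  thus "measure_pmf.expectation (Pi_pmf (insert a A) d p) h =
      measure_pmf.expectation (Pi_pmf A d p) (\<lambda>f. measure_pmf.expectation (p a) (\<lambda>y. h (f(a := y))))"
    using fin by (simp add: expectation_bind_finite)
qed

lemma expectation_mono_finite:
  fixes f g :: "_ \<Rightarrow> real"
  assumes "finite (set_pmf p)" "\<And>x. x \<in> set_pmf p \<Longrightarrow> f x \<le> g x"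
  shows "measure_pmf.expectation p f \<le> measure_pmf.expectation p g"
  using assms by (intro integral_mono_AE integrable_measure_pmf_finite) (auto simp: AE_measure_pmf_iff)

lemma expectation_Cauchy_Schwarz:
  fixes f g :: "_ \<Rightarrow> real"
  assumes fin: "finite (set_pmf p)"
  shows "(measure_pmf.expectation p (\<lambda>x. f x * g x))\<^sup>2
    \<le> measure_pmf.expectation p (\<lambda>x. (f x)\<^sup>2) * measure_pmf.expectation p (\<lambda>x. (g x)\<^sup>2)"
proof -
  note [simp] = integrable_measure_pmf_finite[OF fin]
  have "(measure_pmf.expectation p (\<lambda>x. f x * g x))\<^sup>2
    \<le> measure_pmf.expectation p (\<lambda>x. (g x)\<^sup>2) * measure_pmf.expectation p (\<lambda>x. (f x)\<^sup>2)"
  proof (rule nonneg_quadratic_discriminant)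
    fix t
    have "0 \<le> measure_pmf.expectation p (\<lambda>x. (f x + t * g x)\<^sup>2)" by simp
    also have "(\<lambda>x. (f x + t * g x)\<^sup>2) = (\<lambda>x. (f x)\<^sup>2 + 2 * t * (f x * g x) + t\<^sup>2 * (g x)\<^sup>2)"
      by (auto simp: fun_eq_iff power2_eq_square algebra_simps)
    finally show "0 \<le> measure_pmf.expectation p (\<lambda>x. (f x)\<^sup>2)
        + 2 * t * measure_pmf.expectation p (\<lambda>x. f x * g x)
        + t\<^sup>2 * measure_pmf.expectation p (\<lambda>x. (g x)\<^sup>2)" by simp
  qed
  thus ?thesis by (simp add: mult.commute)
qed

text \<open>Young's inequality removes \<open>4 * s * d^3\<close> in favour of
  \<open>2 * s^2 * d^2 + 2 * d^4\<close>. The term in \<open>s^3 * d\<close> stays, because it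
  averages to zero for a martingale increment \<open>d\<close>.\<close>

lemma fourth_power_add_le:
  fixes s d :: real
  shows "(s + d)^4 \<le> s^4 + 4 * (s^3 * d) + 8 * (s\<^sup>2 * d\<^sup>2) + 3 * d^4"
proof -
  have "0 \<le> 2 * (s * d - d\<^sup>2)\<^sup>2" by simp
  also have "\<dots> = s^4 + 4 * (s^3 * d) + 8 * (s\<^sup>2 * d\<^sup>2) + 3 * d^4 - (s + d)^4"
    by algebra
  finally show ?thesis by simp
qed

lemma fourth_power_add_le_8:
  fixes a b :: real
  shows "(a + b)^4 \<le> 8 * (a^4 + b^4)"
proof -
  have "(a + b)^4 = ((a + b)\<^sup>2)\<^sup>2" by simp
  also have "\<dots> \<le> (2 * (a\<^sup>2 + b\<^sup>2))\<^sup>2"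
    using sum_squares_bound[of a b] zero_le_power2[of "a + b"]
    by (intro power_mono) (auto simp del: zero_le_power2 simp: power2_sum)
  also have "\<dots> = 4 * (a\<^sup>2 + b\<^sup>2)\<^sup>2" by (simp add: power2_eq_square algebra_simps)
  also have "(a\<^sup>2 + b\<^sup>2)\<^sup>2 \<le> 2 * ((a\<^sup>2)\<^sup>2 + (b\<^sup>2)\<^sup>2)"
    using sum_squares_bound[of "a\<^sup>2" "b\<^sup>2"] by (simp add: power2_sum)
  finally show ?thesis by simp
qed

text \<open>A Burkholder-type bound for one martingale step: the increment \<open>d\<close> has conditional mean
  zero given the coordinates with index in \<open>A\<close>.\<close>
lemma fourth_moment_step:
  fixes S w :: "('a \<Rightarrow> real) \<Rightarrow> real" and d :: "('a \<Rightarrow> real) \<Rightarrow> real \<Rightarrow> real"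
  assumes A: "finite A" "m \<notin> A" "\<And>x. x \<in> insert m A \<Longrightarrow> finite (set_pmf (D x))"
    and h: "\<And>f y. h (f(m := y)) = S f + d f y"
    and k: "k \<ge> 1"
    and mean: "\<And>f. measure_pmf.expectation (D m) (d f) = 0"
    and m2: "\<And>f. measure_pmf.expectation (D m) (\<lambda>y. (d f y)\<^sup>2) \<le> k * w f"
    and m4: "\<And>f. measure_pmf.expectation (D m) (\<lambda>y. (d f y)^4) \<le> k * (w f)\<^sup>2"
    and w2: "measure_pmf.expectation (Pi_pmf A 0 D) (\<lambda>f. (w f)\<^sup>2) \<le> k * b\<^sup>2"
    and IH: "measure_pmf.expectation (Pi_pmf A 0 D) (\<lambda>f. (S f)^4) \<le> 16 * k^3 * a\<^sup>2"
    and a: "a \<ge> 0" and b: "b \<ge> 0"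
  shows "measure_pmf.expectation (Pi_pmf (insert m A) 0 D) (\<lambda>f. (h f)^4) \<le> 16 * k^3 * (a + b)\<^sup>2"
proof -
  define P where "P = Pi_pmf A 0 D"
  have finP: "finite (set_pmf P)" and finm: "finite (set_pmf (D m))"
    using A unfolding P_def by (auto intro!: finite_set_Pi_pmf)
  note [simp] = integrable_measure_pmf_finite[OF finP] integrable_measure_pmf_finite[OF finm]
  have inner: "measure_pmf.expectation (D m) (\<lambda>y. (S f + d f y)^4) \<le>
      (S f)^4 + 8 * k * ((S f)\<^sup>2 * w f) + 3 * k * (w f)\<^sup>2" for f
  proof -
    have "measure_pmf.expectation (D m) (\<lambda>y. (S f + d f y)^4) \<le> measure_pmf.expectation (D m)
      (\<lambda>y. (S f)^4 + 4 * ((S f)^3 * d f y) + 8 * ((S f)\<^sup>2 * (d f y)\<^sup>2) + 3 * (d f y)^4)"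
      by (intro expectation_mono_finite finm fourth_power_add_le)
    also have "\<dots> = (S f)^4 + 8 * ((S f)\<^sup>2 * measure_pmf.expectation (D m) (\<lambda>y. (d f y)\<^sup>2))
        + 3 * measure_pmf.expectation (D m) (\<lambda>y. (d f y)^4)"
      using mean[of f] by simp
    also have "\<dots> \<le> (S f)^4 + 8 * ((S f)\<^sup>2 * (k * w f)) + 3 * (k * (w f)\<^sup>2)"
      using m2[of f] m4[of f] by (intro add_mono mult_left_mono) auto
    finally show ?thesis by (simp add: mult_ac)
  qed
  \<comment> \<open>The constant \<open>16 * k^3\<close> reproduces itself: \<open>8 * k\<close>
    times this bound is \<open>16 * k^3 * (2 * a * b)\<close>, exactly the cross term of the square
    to be reached.\<close>
  have cross: "measure_pmf.expectation P (\<lambda>f. (S f)\<^sup>2 * w f) \<le> 4 * k\<^sup>2 * a * b"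
  proof (rule power2_le_imp_le)
    have "(measure_pmf.expectation P (\<lambda>f. (S f)\<^sup>2 * w f))\<^sup>2 \<le>
        measure_pmf.expectation P (\<lambda>f. ((S f)\<^sup>2)\<^sup>2) * measure_pmf.expectation P (\<lambda>f. (w f)\<^sup>2)"
      by (rule expectation_Cauchy_Schwarz[OF finP])
    also have "\<dots> \<le> (16 * k^3 * a\<^sup>2) * (k * b\<^sup>2)"
      using IH w2 k by (intro mult_mono) (auto simp: P_def)
    also have "\<dots> = (4 * k\<^sup>2 * a * b)\<^sup>2" by (simp add: power_mult_distrib eval_nat_numeral)
    finally show "(measure_pmf.expectation P (\<lambda>f. (S f)\<^sup>2 * w f))\<^sup>2 \<le> (4 * k\<^sup>2 * a * b)\<^sup>2" .
    show "0 \<le> 4 * k\<^sup>2 * a * b" using a b by simp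
  qed
  have "measure_pmf.expectation (Pi_pmf (insert m A) 0 D) (\<lambda>f. (h f)^4)
      = measure_pmf.expectation P (\<lambda>f. measure_pmf.expectation (D m) (\<lambda>y. (S f + d f y)^4))"
    unfolding P_def using A by (subst expectation_Pi_pmf_insert(2)) (auto simp: h)
  also have "\<dots> \<le> measure_pmf.expectation P (\<lambda>f. (S f)^4 + 8 * k * ((S f)\<^sup>2 * w f) + 3 * k * (w f)\<^sup>2)"
    by (intro expectation_mono_finite finP inner)
  also have "\<dots> = measure_pmf.expectation P (\<lambda>f. (S f)^4)
      + 8 * k * measure_pmf.expectation P (\<lambda>f. (S f)\<^sup>2 * w f)
      + 3 * k * measure_pmf.expectation P (\<lambda>f. (w f)\<^sup>2)" by simp
  also have "\<dots> \<le> 16 * k^3 * a\<^sup>2 + 8 * k * (4 * k\<^sup>2 * a * b) + 3 * k * (k * b\<^sup>2)"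
    using IH w2 cross k unfolding P_def by (intro add_mono mult_left_mono) auto
  also have "3 * k * (k * b\<^sup>2) \<le> 16 * k^3 * b\<^sup>2"
  proof -
    have "k\<^sup>2 \<le> k^3" using k by (intro power_increasing) auto
    hence "3 * k\<^sup>2 * b\<^sup>2 \<le> 16 * k^3 * b\<^sup>2" using k by (intro mult_right_mono mult_mono) auto
    thus ?thesis by (simp add: power2_eq_square mult_ac)
  qed
  also have "16 * k^3 * a\<^sup>2 + 8 * k * (4 * k\<^sup>2 * a * b) + 16 * k^3 * b\<^sup>2 = 16 * k^3 * (a + b)\<^sup>2"
    by (simp add: power2_sum algebra_simps eval_nat_numeral)
  finally show ?thesis by simp
qed

section \<open>Fourth moments of linear and quadratic forms in independent centered
  coordinates\<close>

context
  fixes D :: "nat \<Rightarrow> real pmf" and c :: real and n :: nat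
  assumes fin: "\<And>i. i < n \<Longrightarrow> finite (set_pmf (D i))"
    and mean0: "\<And>i. i < n \<Longrightarrow> measure_pmf.expectation (D i) (\<lambda>x. x) = 0"
    and var1: "\<And>i. i < n \<Longrightarrow> measure_pmf.expectation (D i) (\<lambda>x. x\<^sup>2) \<le> 1"
    and mom8: "\<And>i. i < n \<Longrightarrow> 1 + measure_pmf.expectation (D i) (\<lambda>x. x^8) \<le> c"
begin

private lemma finPi: "m \<le> n \<Longrightarrow> finite (set_pmf (Pi_pmf {..<m} 0 D))"
  using fin by (intro finite_set_Pi_pmf) auto

private lemma c1: "i < n \<Longrightarrow> c \<ge> 1"
proof -
  assume i: "i < n"
  have "0 \<le> measure_pmf.expectation (D i) (\<lambda>x. x^8)" by simp
  with mom8[OF i] show "c \<ge> 1" by linarith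
qed

text \<open>From \<open>x^4 \<le> 1 + x^8\<close>; the summand 1 in \<open>mom8\<close> is there so
  that a single constant \<open>c \<ge> 1\<close> bounds both moments.\<close>

private lemma mom4:
  assumes i: "i < n"
  shows "measure_pmf.expectation (D i) (\<lambda>x. x^4) \<le> c"
proof -
  note [simp] = integrable_measure_pmf_finite[OF fin[OF i]]
  have "x^4 \<le> 1 + x^8" for x :: real
  proof -
    have "0 \<le> (x^4 - 1)\<^sup>2 + x^8 + 1" by simp
    thus ?thesis by (simp add: power2_eq_square algebra_simps flip: power_add)
  qed
  hence "measure_pmf.expectation (D i) (\<lambda>x. x^4) \<le> measure_pmf.expectation (D i) (\<lambda>x. 1 + x^8)"
    by (intro expectation_mono_finite fin i)
  thus ?thesis using mom8[OF i] by simp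
qed

private lemma linear_form_fourth_moment:
  "m \<le> n \<Longrightarrow> measure_pmf.expectation (Pi_pmf {..<m} 0 D) (\<lambda>x. (\<Sum>j<m. t j * x j)^4)
    \<le> 16 * c^3 * (\<Sum>j<m. (t j)\<^sup>2)\<^sup>2"
proof (induction m)
  case 0
  show ?case by simp
next
  case (Suc m)
  hence m: "m < n" by simp
  have "measure_pmf.expectation (Pi_pmf (insert m {..<m}) 0 D) (\<lambda>x. (\<Sum>j<Suc m. t j * x j)^4)
    \<le> 16 * c^3 * ((\<Sum>j<m. (t j)\<^sup>2) + (t m)\<^sup>2)\<^sup>2"
  proof (rule fourth_moment_step[where S = "\<lambda>x. \<Sum>j<m. t j * x j" and d = "\<lambda>_ y. t m * y"
        and w = "\<lambda>_. (t m)\<^sup>2"])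
    note [simp] = integrable_measure_pmf_finite[OF fin[OF m]]
    show "measure_pmf.expectation (D m) ((*) (t m)) = 0"
      using mean0[OF m] by simp
    have "(t m)\<^sup>2 * measure_pmf.expectation (D m) (\<lambda>x. x\<^sup>2) \<le> (t m)\<^sup>2 * c"
      using var1[OF m] c1[OF m] by (intro mult_left_mono) auto
    thus "measure_pmf.expectation (D m) (\<lambda>y. (t m * y)\<^sup>2) \<le> c * (t m)\<^sup>2"
      by (simp add: power_mult_distrib mult_ac)
    have "(t m)^4 * measure_pmf.expectation (D m) (\<lambda>x. x^4) \<le> (t m)^4 * c"
      using mom4[OF m] by (intro mult_left_mono) auto
    thus "measure_pmf.expectation (D m) (\<lambda>y. (t m * y)^4) \<le> c * ((t m)\<^sup>2)\<^sup>2"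
      by (simp add: power_mult_distrib mult_ac)
    have "1 * ((t m)\<^sup>2)\<^sup>2 \<le> c * ((t m)\<^sup>2)\<^sup>2" using c1[OF m] by (intro mult_right_mono) auto
    thus "measure_pmf.expectation (Pi_pmf {..<m} 0 D) (\<lambda>f. ((t m)\<^sup>2)\<^sup>2) \<le> c * ((t m)\<^sup>2)\<^sup>2" by simp
  qed (use Suc fin c1[OF m] in \<open>auto intro!: sum_nonneg\<close>)
  thus ?case by (simp add: lessThan_Suc add.commute)
qed

text \<open>Revealing the coordinates in turn makes the centered form a martingale. Coordinate
  \<open>m\<close> contributes \<open>T m m * (y^2 - \<tau> m)\<close> plus \<open>2 * y\<close>
  times a linear form in the earlier coordinates, whose fourth moment is already bounded. The square
  in the first part brings in eighth moments.\<close>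

lemma quad_form_fourth_moment:
  assumes sym: "sym_mat n T"
  shows "measure_pmf.expectation (Pi_pmf {..<n} 0 D)
      (\<lambda>x. (quad_form n T x - (\<Sum>i<n. T i i * measure_pmf.expectation (D i) (\<lambda>y. y\<^sup>2)))^4)
    \<le> 16 * (160 * c^3)^3 * (frob2 n T)\<^sup>2"
proof -
  define \<tau> where "\<tau> = (\<lambda>i. measure_pmf.expectation (D i) (\<lambda>y. y\<^sup>2))"
  have "m \<le> n \<Longrightarrow> measure_pmf.expectation (Pi_pmf {..<m} 0 D)
      (\<lambda>x. (quad_form m T x - (\<Sum>i<m. T i i * \<tau> i))^4) \<le> 16 * (160 * c^3)^3 * (frob2 m T)\<^sup>2" for m
  proof (induction m)
    case 0
    show ?case by (simp add: quad_form_def frob2_def)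
  next
    case (Suc m)
    hence m: "m < n" by simp
    note [simp] = integrable_measure_pmf_finite[OF fin[OF m]]
    have c: "c \<ge> 1" using c1[OF m] .
    have c3: "c \<le> c^3" "1 \<le> c^3" using c power_increasing[of 1 3 c] by auto
    have \<tau>: "0 \<le> \<tau> m" "\<tau> m \<le> 1" using var1[OF m] by (auto simp: \<tau>_def)
    define g where "g = (\<lambda>x. \<Sum>j<m. T m j * x j)"
    \<comment> \<open>Share of row \<open>m\<close> in the Frobenius norm, on and left of the
      diagonal; the shares add up to at most \<open>frob2\<close>.\<close>
    define b where "b = (T m m)\<^sup>2 + (\<Sum>j<m. (T m j)\<^sup>2)"
    define d where "d = (\<lambda>x y. T m m * (y\<^sup>2 - \<tau> m) + 2 * g x * y)"
    define w where "w = (\<lambda>x. (T m m)\<^sup>2 + (g x)\<^sup>2)"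
    have Tsym: "(\<Sum>j<m. T j m * f j) = g f" for f
      using sym m unfolding g_def by (intro sum.cong) (auto simp: sym_mat_def)
    have rec: "quad_form (Suc m) T (f(m := y)) - (\<Sum>i<Suc m. T i i * \<tau> i)
        = (quad_form m T f - (\<Sum>i<m. T i i * \<tau> i)) + d f y" for f y
    proof -
      have "quad_form (Suc m) T (f(m := y)) =
          quad_form m T f + (\<Sum>i<m. T i m * f i) * y + g f * y + T m m * y\<^sup>2"
        by (simp add: quad_form_def g_def sum.distrib sum_distrib_right sum_distrib_left
            power2_eq_square mult_ac)
      thus ?thesis unfolding Tsym by (simp add: d_def algebra_simps)
    qed
    \<comment> \<open>\<open>160 * c^3\<close> serves as \<open>k\<close> for all three moment
      conditions of the step, which need at most 8, 128 and 32 times \<open>c^3\<close>.\<close>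
    have "measure_pmf.expectation (Pi_pmf (insert m {..<m}) 0 D)
      (\<lambda>x. (quad_form (Suc m) T x - (\<Sum>i<Suc m. T i i * \<tau> i))^4) \<le> 16 * (160 * c^3)^3 * (frob2 m T + b)\<^sup>2"
    proof (rule fourth_moment_step[where d = d and w = w, OF _ _ _ rec])
      show "measure_pmf.expectation (D m) (d f) = 0" for f
        using mean0[OF m] by (simp add: d_def[abs_def] \<tau>_def)
      show "measure_pmf.expectation (D m) (\<lambda>y. (d f y)\<^sup>2) \<le> 160 * c^3 * w f" for f
      proof -
        have "(d f y)\<^sup>2 \<le> 4 * (T m m)\<^sup>2 * (1 + y^4) + 8 * (g f)\<^sup>2 * y\<^sup>2" for y
        proof -
          have "(y\<^sup>2 - \<tau> m)\<^sup>2 \<le> 2 * (1 + y^4)"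
          proof -
            have "(y\<^sup>2 - \<tau> m)\<^sup>2 \<le> 2 * ((y\<^sup>2)\<^sup>2 + (\<tau> m)\<^sup>2)"
              using zero_le_power2[of "y\<^sup>2 + \<tau> m"] by (simp add: power2_eq_square algebra_simps)
            moreover have "(\<tau> m)\<^sup>2 \<le> 1" using \<tau> by (simp add: power_le_one)
            ultimately show ?thesis by simp
          qed
          hence "2 * (T m m)\<^sup>2 * (y\<^sup>2 - \<tau> m)\<^sup>2 \<le> 2 * (T m m)\<^sup>2 * (2 * (1 + y^4))" by (intro mult_left_mono) auto
          moreover have "(d f y)\<^sup>2 \<le> 2 * ((T m m * (y\<^sup>2 - \<tau> m))\<^sup>2 + (2 * g f * y)\<^sup>2)"
            using sum_squares_bound[of "T m m * (y\<^sup>2 - \<tau> m)" "2 * g f * y"]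
            by (simp add: d_def power2_sum)
          moreover define e where "e = y\<^sup>2 - \<tau> m"
          ultimately show ?thesis unfolding e_def[symmetric] by (simp add: power_mult_distrib algebra_simps)
        qed
        hence "measure_pmf.expectation (D m) (\<lambda>y. (d f y)\<^sup>2) \<le> measure_pmf.expectation (D m)
            (\<lambda>y. 4 * (T m m)\<^sup>2 * (1 + y^4) + 8 * (g f)\<^sup>2 * y\<^sup>2)"
          by (intro expectation_mono_finite fin m)
        also have "\<dots> = 4 * (T m m)\<^sup>2 * (1 + measure_pmf.expectation (D m) (\<lambda>y. y^4)) + 8 * (g f)\<^sup>2 * \<tau> m"
          by (simp add: \<tau>_def)
        also have "\<dots> \<le> 4 * (T m m)\<^sup>2 * (2 * c^3) + 8 * (g f)\<^sup>2 * c^3"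
          using mom4[OF m] \<tau> c3 by (intro add_mono mult_left_mono) auto
        also have "\<dots> = 8 * c^3 * w f" by (simp add: w_def algebra_simps)
        also have "\<dots> \<le> 160 * c^3 * w f"
          using c c3 by (intro mult_right_mono) (auto simp: w_def)
        finally show ?thesis .
      qed
      show "measure_pmf.expectation (D m) (\<lambda>y. (d f y)^4) \<le> 160 * c^3 * (w f)\<^sup>2" for f
      proof -
        have "(d f y)^4 \<le> 64 * (T m m)^4 * (1 + y^8) + 128 * (g f)^4 * y^4" for y
        proof -
          have "(y\<^sup>2 - \<tau> m)^4 \<le> 8 * (1 + y^8)"
          proof -
            have "(y\<^sup>2 + - \<tau> m)^4 \<le> 8 * ((y\<^sup>2)^4 + (-\<tau> m)^4)" by (rule fourth_power_add_le_8)
            moreover have "(\<tau> m)^4 \<le> 1" using \<tau> by (simp add: power_le_one)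
            ultimately show ?thesis by simp
          qed
          hence "8 * (T m m)^4 * (y\<^sup>2 - \<tau> m)^4 \<le> 8 * (T m m)^4 * (8 * (1 + y^8))" by (intro mult_left_mono) auto
          moreover have "(d f y)^4 \<le> 8 * ((T m m * (y\<^sup>2 - \<tau> m))^4 + (2 * g f * y)^4)"
            unfolding d_def by (rule fourth_power_add_le_8)
          moreover define e where "e = y\<^sup>2 - \<tau> m"
          ultimately show ?thesis unfolding e_def[symmetric] by (simp add: power_mult_distrib algebra_simps)
        qed
        hence "measure_pmf.expectation (D m) (\<lambda>y. (d f y)^4) \<le> measure_pmf.expectation (D m)
            (\<lambda>y. 64 * (T m m)^4 * (1 + y^8) + 128 * (g f)^4 * y^4)"
          by (intro expectation_mono_finite fin m)
        also have "\<dots> = 64 * (T m m)^4 * (1 + measure_pmf.expectation (D m) (\<lambda>y. y^8))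
            + 128 * (g f)^4 * measure_pmf.expectation (D m) (\<lambda>y. y^4)" by simp
        also have "\<dots> \<le> 64 * (T m m)^4 * c^3 + 128 * (g f)^4 * c^3"
          using mom4[OF m] mom8[OF m] c3 by (intro add_mono mult_left_mono) auto
        also have "\<dots> \<le> 160 * c^3 * ((T m m)^4 + (g f)^4)"
          using c c3 by (simp add: algebra_simps)
        also have "\<dots> \<le> 160 * c^3 * (w f)\<^sup>2"
          using c c3 by (intro mult_left_mono) (auto simp: w_def power2_sum)
        finally show ?thesis .
      qed
      show "measure_pmf.expectation (Pi_pmf {..<m} 0 D) (\<lambda>f. (w f)\<^sup>2) \<le> 160 * c^3 * b\<^sup>2"
      proof -
        have mn: "m \<le> n" using m by simp
        note [simp] = integrable_measure_pmf_finite[OF finPi[OF mn]]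
        have "(w f)\<^sup>2 \<le> 2 * (T m m)^4 + 2 * (g f)^4" for f
          using sum_squares_bound[of "(T m m)\<^sup>2" "(g f)\<^sup>2"] by (simp add: w_def power2_sum)
        hence "measure_pmf.expectation (Pi_pmf {..<m} 0 D) (\<lambda>f. (w f)\<^sup>2) \<le>
            measure_pmf.expectation (Pi_pmf {..<m} 0 D) (\<lambda>f. 2 * (T m m)^4 + 2 * (g f)^4)"
          by (intro expectation_mono_finite finPi mn)
        also have "\<dots> = 2 * (T m m)^4 + 2 * measure_pmf.expectation (Pi_pmf {..<m} 0 D) (\<lambda>f. (g f)^4)"
          by simp
        also have "\<dots> \<le> 2 * (T m m)^4 + 2 * (16 * c^3 * (\<Sum>j<m. (T m j)\<^sup>2)\<^sup>2)"
          using linear_form_fourth_moment[OF mn, of "T m"] unfolding g_def by simp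
        also have "\<dots> \<le> 160 * c^3 * (T m m)^4 + 160 * c^3 * (\<Sum>j<m. (T m j)\<^sup>2)\<^sup>2"
        proof (rule add_mono)
          show "2 * (T m m)^4 \<le> 160 * c^3 * (T m m)^4" using c c3 by (intro mult_right_mono) auto
          show "2 * (16 * c^3 * (\<Sum>j<m. (T m j)\<^sup>2)\<^sup>2) \<le> 160 * c^3 * (\<Sum>j<m. (T m j)\<^sup>2)\<^sup>2"
            using c c3 by (simp add: mult_right_mono)
        qed
        also have "\<dots> = 160 * c^3 * (((T m m)\<^sup>2)\<^sup>2 + (\<Sum>j<m. (T m j)\<^sup>2)\<^sup>2)"
          by (simp add: algebra_simps)
        also have "\<dots> \<le> 160 * c^3 * b\<^sup>2"
        proof (rule mult_left_mono)
          have "0 \<le> (\<Sum>j<m. (T m j)\<^sup>2)" by (intro sum_nonneg) auto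
          thus "((T m m)\<^sup>2)\<^sup>2 + (\<Sum>j<m. (T m j)\<^sup>2)\<^sup>2 \<le> b\<^sup>2" unfolding b_def power2_sum by simp
        qed (use c c3 in auto)
        finally show ?thesis .
      qed
      show "0 \<le> b" unfolding b_def by (intro add_nonneg_nonneg sum_nonneg) auto
    qed (use Suc fin c3 in \<open>auto simp: frob2_nonneg\<close>)
    also have "\<dots> \<le> 16 * (160 * c^3)^3 * (frob2 (Suc m) T)\<^sup>2"
    proof (rule mult_left_mono[OF power_mono])
      have "(\<Sum>i<m. (T i m)\<^sup>2) \<ge> 0" by (intro sum_nonneg) auto
      thus "frob2 m T + b \<le> frob2 (Suc m) T" by (simp add: frob2_def b_def sum.distrib)
      show "0 \<le> frob2 m T + b" unfolding b_def
        by (intro add_nonneg_nonneg sum_nonneg frob2_nonneg) auto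
    qed (use c c3 in auto)
    finally show ?case by (simp add: lessThan_Suc)
  qed
  from this[of n] show ?thesis by (simp add: \<tau>_def)
qed

lemma expectation_quad_form:
  assumes sym: "sym_mat n T"
  shows "measure_pmf.expectation (Pi_pmf {..<n} 0 D) (quad_form n T) =
    (\<Sum>i<n. T i i * measure_pmf.expectation (D i) (\<lambda>y. y\<^sup>2))"
proof -
  have "m \<le> n \<Longrightarrow> measure_pmf.expectation (Pi_pmf {..<m} 0 D) (quad_form m T) =
    (\<Sum>i<m. T i i * measure_pmf.expectation (D i) (\<lambda>y. y\<^sup>2))" for m
  proof (induction m)
    case 0
    show ?case by (simp add: quad_form_def)
  next
    case (Suc m)
    hence m: "m < n" by simp
    hence mn: "m \<le> n" by simp
    note [simp] = integrable_measure_pmf_finite[OF fin[OF m]] integrable_measure_pmf_finite[OF finPi[OF mn]]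
    define g where "g = (\<lambda>f. (\<Sum>i<m. T i m * f i) + (\<Sum>j<m. T m j * f j))"
    have rec: "quad_form (Suc m) T (f(m := y)) = quad_form m T f + g f * y + T m m * y\<^sup>2" for f y
      by (simp add: quad_form_def g_def sum.distrib sum_distrib_right sum_distrib_left
          power2_eq_square mult_ac distrib_left)
    have "measure_pmf.expectation (Pi_pmf (insert m {..<m}) 0 D) (quad_form (Suc m) T) =
      measure_pmf.expectation (Pi_pmf {..<m} 0 D)
        (\<lambda>f. quad_form m T f + T m m * measure_pmf.expectation (D m) (\<lambda>y. y\<^sup>2))"
      using fin Suc.prems mean0[OF m] by (subst expectation_Pi_pmf_insert(2)) (auto simp: rec)
    thus ?case using Suc by (simp add: lessThan_Suc)
  qed
  thus ?thesis by simp
qed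

end

section \<open>The barrier argument\<close>

lemma quad_form_shift_rank_one:
  "quad_form n (\<lambda>i j. H i j + (if i = j then \<delta> else 0) + c * v i * v j) w =
    quad_form n H w + \<delta> * (\<Sum>j<n. (w j)\<^sup>2) + c * (\<Sum>j<n. v j * w j)\<^sup>2"
proof -
  have diag: "(\<Sum>j<n. (if i = j then \<delta> else 0) * w i * w j) = \<delta> * (w i)\<^sup>2" if "i < n" for i
  proof -
    have "(\<Sum>j<n. (if i = j then \<delta> else 0) * w i * w j) = (\<Sum>j<n. if i = j then \<delta> * w i * w j else 0)"
      by (intro sum.cong) auto
    thus ?thesis using that by (simp add: power2_eq_square mult_ac)
  qed
  have "quad_form n (\<lambda>i j. H i j + (if i = j then \<delta> else 0) + c * v i * v j) w =
    quad_form n H w + (\<Sum>i<n. \<Sum>j<n. (if i = j then \<delta> else 0) * w i * w j)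
      + (\<Sum>i<n. \<Sum>j<n. c * ((v i * w i) * (v j * w j)))"
    unfolding quad_form_def by (simp add: sum.distrib[symmetric] algebra_simps)
  also have "(\<Sum>i<n. \<Sum>j<n. (if i = j then \<delta> else 0) * w i * w j) = \<delta> * (\<Sum>j<n. (w j)\<^sup>2)"
    by (simp add: diag sum_distrib_left)
  also have "(\<Sum>i<n. \<Sum>j<n. c * ((v i * w i) * (v j * w j))) = c * (\<Sum>j<n. v j * w j)\<^sup>2"
    unfolding power2_eq_square sum_product unfolding sum_distrib_left ..
  finally show ?thesis .
qed

text \<open>\<open>D i j\<close> is the law of an entry before division by
  \<open>sqrt (n - 1)\<close>. \<open>\<eta>\<close> is the slack in the potential; \<open>K\<close>
  sets both the threshold \<open>n K\<close> for a large \<open>frob2\<close> and the charge for an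
  extra shift; \<open>s / n\<close> is the size of that shift. \<open>nN\<close> and
  \<open>s_large\<close> are what the argument asks of large \<open>n\<close>.\<close>

locale barrier =
  fixes n :: nat and D :: "nat \<Rightarrow> nat \<Rightarrow> real pmf" and c \<eta> K s :: real
  assumes n2: "n \<ge> 2"
    and fin: "\<And>i j. i < n \<Longrightarrow> j < n \<Longrightarrow> finite (set_pmf (D i j))"
    and mean0: "\<And>i j. i < n \<Longrightarrow> j < n \<Longrightarrow> measure_pmf.expectation (D i j) (\<lambda>x. x) = 0"
    and var1: "\<And>i j. i < n \<Longrightarrow> j < n \<Longrightarrow> measure_pmf.expectation (D i j) (\<lambda>x. x\<^sup>2) \<le> 1"
    and mom8: "\<And>i j. i < n \<Longrightarrow> j < n \<Longrightarrow> 1 + measure_pmf.expectation (D i j) (\<lambda>x. x^8) \<le> c"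
    and \<eta>: "0 < \<eta>" "\<eta> \<le> 1/12"
    and K: "0 < K" and s: "0 < s"
    and nN: "(1/2 + \<eta>) * (real n / (real n - 1)) + \<eta> \<le> 1/2 + 3 * \<eta>"
    and s_large: "1 / ((real n - 1) * (1/2 - 3 * \<eta>)) \<le> s / real n"
begin

definition N where "N = real n - 1"
text \<open>While the potential is below \<open>(1/2 + \<eta>) n\<close>, the mean of
  \<open>y^T P y / N\<close> is at most \<open>\<theta> - \<eta>\<close> by \<open>nN\<close>, so a
  value above \<open>\<theta>\<close> is a deviation of at least \<open>\<eta>\<close>.\<close>

definition \<theta> where "\<theta> = 1/2 + 3 * \<eta>"
text \<open>With the Sherman-Morrison denominator at least \<open>1 - \<theta>\<close>, the mean
  growth of the trace is at most \<open>\<delta>0 * frob2 n P\<close>; a shift by just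
  \<open>\<delta>0\<close> lowers the trace by at least as much.\<close>

definition \<delta>0 where "\<delta>0 = 1 / (N * (1 - \<theta>))"
text \<open>An extra shift is charged \<open>K\<close> and is made only while trace plus charges is
  at most \<open>n\<close>, so there were at most \<open>n / K\<close> before it; the 1 makes room
  for the shift itself.\<close>

definition Bmax where "Bmax = real n / K + 1"
definition C where "C = 16 * (160 * c^3)^3"
text \<open>Risk of one row per unit of squared \<open>frob2\<close>: the first summand is Markov's
  inequality for the fourth power when \<open>\<theta>\<close> is passed, the second the variance
  added to the martingale, on the scale \<open>(\<eta> n)^2\<close>.\<close>

definition \<kappa> where "\<kappa> = C * (1 / (N^4 * \<eta>^4) + 1 / (N\<^sup>2 * (1 - \<theta>)\<^sup>2 * (\<eta> * real n)\<^sup>2))"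
text \<open>\<open>g1\<close> is the risk of a row when \<open>frob2\<close> is at most
  \<open>n K\<close>, and \<open>g2\<close> the risk after an extra shift, when it is at most
  \<open>n^2 / s\<close>.\<close>

definition g1 where "g1 = \<kappa> * (real n * K)\<^sup>2"
definition g2 where "g2 = \<kappa> * ((real n)\<^sup>2 / s)\<^sup>2"
definition row where "row i = Pi_pmf {..<n} 0 (D i)"

text \<open>Barrier movement still in reserve when rows \<open>k..<n\<close> remain and
  \<open>b\<close> extra shifts have been made. Reserving it in advance makes the final barrier
  deterministic although the number of extra shifts is random.\<close>

definition shift_left where
  "shift_left k b = real (n - k) * \<delta>0 + (Bmax - b) * (s / real n)"

text \<open>\<open>M\<close> is the current value of the martingale that dominates the growth of the potential. Its
  square plus an allowance for the remaining regular and extra steps is a supermartingale that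
  is at least 1 once the potential exceeds \<open>(1/2 + \<eta>) n\<close>.\<close>
definition risk_bound where
  "risk_bound k b M = M\<^sup>2 / (\<eta> * real n)\<^sup>2 + real (n - k) * g1 + (Bmax - b) * g2"

text \<open>The event that the remaining rows lift the Gram sum past the barrier, even after it has
  moved by a further \<open>t\<close>. Homogeneity in \<open>w\<close> replaces unit vectors. Only
  the rows from \<open>k\<close> on are read, so the earlier ones can be absorbed in
  \<open>H\<close>.\<close>

definition barrier_crossed :: "nat \<Rightarrow> (nat \<Rightarrow> nat \<Rightarrow> real) \<Rightarrow> real \<Rightarrow> (nat \<Rightarrow> nat \<Rightarrow> real) set" where
  "barrier_crossed k H t = {x. \<exists>w. (\<Sum>i=k..<n. (\<Sum>j<n. x i j * w j)\<^sup>2 / N)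
      > quad_form n H w + t * (\<Sum>j<n. (w j)\<^sup>2)}"

lemma N_ge_1: "N \<ge> 1" using n2 by (simp add: N_def)
lemma \<theta>_bounds: "\<theta> < 1" "\<theta> > 0" using \<eta> by (simp_all add: \<theta>_def)
lemma \<delta>0_pos: "\<delta>0 > 0" using N_ge_1 \<theta>_bounds by (simp add: \<delta>0_def)
lemma s_\<delta>0: "\<delta>0 \<le> s / real n" using s_large by (simp add: \<delta>0_def \<theta>_def N_def)

lemma \<delta>0_mult_n: "\<delta>0 * real n \<ge> 1"
proof -
  have "N * (1 - \<theta>) \<le> N * 1" using \<theta>_bounds N_ge_1 by (intro mult_left_mono) auto
  hence "N * (1 - \<theta>) \<le> real n" by (simp add: N_def)
  moreover have "0 < N * (1 - \<theta>)" using N_ge_1 \<theta>_bounds by simp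
  ultimately show ?thesis by (simp add: \<delta>0_def)
qed

lemma C_ge_1: "C \<ge> 1"
proof -
  have "0 \<le> measure_pmf.expectation (D 0 0) (\<lambda>x. x^8)" by simp
  moreover have "1 + measure_pmf.expectation (D 0 0) (\<lambda>x. x^8) \<le> c" using n2 by (intro mom8) auto
  ultimately have "1 \<le> c" by linarith
  hence "1 \<le> c^3" by (rule one_le_power)
  hence "1 \<le> 160 * c^3" by simp
  hence "1 \<le> (160 * c^3)^3" by (rule one_le_power)
  thus ?thesis by (simp add: C_def)
qed

lemma \<kappa>_nonneg: "\<kappa> \<ge> 0" using C_ge_1 by (simp add: \<kappa>_def)
lemma g1_nonneg: "g1 \<ge> 0" using \<kappa>_nonneg by (simp add: g1_def)
lemma g2_nonneg: "g2 \<ge> 0" using \<kappa>_nonneg by (simp add: g2_def)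

lemma finite_row: "i < n \<Longrightarrow> finite (set_pmf (row i))"
  using fin by (auto simp: row_def intro!: finite_set_Pi_pmf)

lemma fourth_moment:
  assumes "k < n" "sym_mat n T"
  shows "measure_pmf.expectation (row k)
     (\<lambda>x. (quad_form n T x - measure_pmf.expectation (row k) (quad_form n T))^4) \<le> C * (frob2 n T)\<^sup>2"
proof -
  have "measure_pmf.expectation (row k) (quad_form n T) =
      (\<Sum>i<n. T i i * measure_pmf.expectation (D k i) (\<lambda>y. y\<^sup>2))"
    unfolding row_def using assms fin mean0 var1 mom8 by (intro expectation_quad_form) auto
  moreover have "measure_pmf.expectation (Pi_pmf {..<n} 0 (D k))
     (\<lambda>x. (quad_form n T x - (\<Sum>i<n. T i i * measure_pmf.expectation (D k i) (\<lambda>y. y\<^sup>2)))^4)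
     \<le> 16 * (160 * c^3)^3 * (frob2 n T)\<^sup>2"
    using assms fin mean0 var1 mom8 by (intro quad_form_fourth_moment) auto
  ultimately show ?thesis by (simp add: row_def C_def)
qed

lemma expectation_row_psd:
  assumes "k < n" "psd_mat n T"
  shows "measure_pmf.expectation (row k) (quad_form n T) \<le> trace_mat n T"
proof -
  have "measure_pmf.expectation (row k) (quad_form n T) =
      (\<Sum>i<n. T i i * measure_pmf.expectation (D k i) (\<lambda>y. y\<^sup>2))"
    unfolding row_def using assms fin mean0 var1 mom8
    by (intro expectation_quad_form) (auto simp: psd_mat_def)
  also have "\<dots> \<le> (\<Sum>i<n. T i i * 1)"
    using assms var1 psd_diag_nonneg[OF assms(2)] by (intro sum_mono mult_left_mono) auto
  finally show ?thesis by (simp add: trace_mat_def)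
qed

text \<open>The regular shift \<open>\<delta>0\<close> is followed by the large extra shift \<open>s / n\<close> if the resolvent is
  still too singular. Each extra shift costs \<open>K\<close> units of the potential, so it happens at most
  \<open>n / K\<close> times.\<close>
lemma choose_shift:
  assumes psd: "psd_mat n Q" and inv: "right_inverse_mat n H Q" and H: "sym_mat n H"
    and pot: "trace_mat n Q + K * b \<le> (1/2 + \<eta>) * real n" and b: "b \<ge> 0"
  obtains P b' where "psd_mat n P" "b' \<ge> 0" "b' \<le> Bmax"
    "right_inverse_mat n (\<lambda>i j. H i j + (if i = j then \<delta>0 + (b' - b) * (s / real n) else 0)) P"
    "trace_mat n P + \<delta>0 * frob2 n P + K * b' \<le> trace_mat n Q + K * b"
    "\<kappa> * (frob2 n P)\<^sup>2 \<le> g1 + (b' - b) * g2"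
proof -
  have n0: "real n > 0" using n2 by simp
  have trQ: "trace_mat n Q \<ge> 0" by (rule psd_trace_nonneg[OF psd])
  have "(1/2 + \<eta>) * real n \<le> 1 * real n" using \<eta> by (intro mult_right_mono) auto
  hence pot1: "trace_mat n Q + K * b \<le> real n" using pot by simp
  hence "K * b \<le> real n" using trQ by simp
  hence bB: "b + 1 \<le> Bmax" using K by (simp add: Bmax_def field_simps)
  have "0 \<le> K * b" using b K by simp
  hence trQn: "trace_mat n Q \<le> real n" using pot1 by linarith
  obtain P where P: "psd_mat n P" "right_inverse_mat n (\<lambda>i j. H i j + (if i = j then \<delta>0 else 0)) P"
      "trace_mat n P + \<delta>0 * frob2 n P \<le> trace_mat n Q"
    using resolvent_shift[OF psd inv H less_imp_le[OF \<delta>0_pos]] by blast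
  show ?thesis
  proof (cases "frob2 n P \<le> real n * K")
    case True
    have "\<kappa> * (frob2 n P)\<^sup>2 \<le> \<kappa> * (real n * K)\<^sup>2"
      using True \<kappa>_nonneg frob2_nonneg by (intro mult_left_mono power_mono) auto
    with P b bB show ?thesis by (intro that[of P b]) (auto simp: g1_def cong: if_cong)
  next
    case False
    have symH: "sym_mat n (\<lambda>i j. H i j + (if i = j then \<delta>0 else 0))"
      using H by (auto simp: sym_mat_def)
    have sn: "s / real n \<ge> 0" using s by simp
    obtain R where R: "psd_mat n R"
        "right_inverse_mat n (\<lambda>i j. H i j + (if i = j then \<delta>0 else 0) + (if i = j then s / real n else 0)) R"
        "trace_mat n R + s / real n * frob2 n R \<le> trace_mat n P"
      using resolvent_shift[OF P(1,2) symH sn] by blast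
    \<comment> \<open>A large \<open>frob2 n P\<close> means that the regular shift alone has
      already lowered the trace by \<open>K\<close>: this pays for raising \<open>b\<close> by
      1.\<close>
    have "K \<le> \<delta>0 * real n * K" using mult_right_mono[OF \<delta>0_mult_n, of K] K by simp
    also have "\<dots> \<le> \<delta>0 * frob2 n P"
      using False \<delta>0_pos by (simp add: mult.assoc)
    finally have trP: "trace_mat n P + K \<le> trace_mat n Q" using P(3) by simp
    have trR: "trace_mat n R \<ge> 0" by (rule psd_trace_nonneg[OF R(1)])
    \<comment> \<open>The trace cannot drop by more than \<open>n\<close>, which bounds
      \<open>frob2 n R\<close> however large \<open>frob2 n P\<close> was.\<close>
    have "s / real n * frob2 n R \<le> real n" using R(3) trP trQn trR K by simp
    hence fR: "frob2 n R \<le> (real n)\<^sup>2 / s" using s n0 by (simp add: field_simps power2_eq_square)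
    \<comment> \<open>The drop from the extra shift thus also covers the mean growth
      \<open>\<delta>0 * frob2 n R\<close> of the coming row.\<close>
    have "\<delta>0 * frob2 n R \<le> s / real n * frob2 n R"
      using s_\<delta>0 frob2_nonneg by (rule mult_right_mono)
    hence tr: "trace_mat n R + \<delta>0 * frob2 n R + K * (b + 1) \<le> trace_mat n Q + K * b"
      using R(3) trP by (simp add: algebra_simps)
    have "\<kappa> * (frob2 n R)\<^sup>2 \<le> g2"
      unfolding g2_def using fR \<kappa>_nonneg frob2_nonneg by (intro mult_left_mono power_mono) auto
    moreover have "right_inverse_mat n
        (\<lambda>i j. H i j + (if i = j then \<delta>0 + ((b + 1) - b) * (s / real n) else 0)) R"
    proof -
      have "(\<lambda>i j. H i j + (if i = j then \<delta>0 + ((b + 1) - b) * (s / real n) else 0)) =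
        (\<lambda>i j. H i j + (if i = j then \<delta>0 else 0) + (if i = j then s / real n else 0))"
        by (auto simp: fun_eq_iff)
      thus ?thesis using R(2) by simp
    qed
    ultimately show ?thesis
      using R(1) tr b bB g1_nonneg by (intro that[of R "b + 1"]) (auto cong: if_cong)
  qed
qed

text \<open>Sherman-Morrison with \<open>c = - (1 / N)\<close>. The condition \<open>q\<close> keeps
  the row short of the barrier and the denominator above \<open>1 - \<theta>\<close>, so that the
  growth is bounded linearly in the form of \<open>P^2\<close>.\<close>

lemma rank_one_step:
  fixes y :: "nat \<Rightarrow> real"
  assumes psd: "psd_mat n P" and inv: "right_inverse_mat n H P" and H: "sym_mat n H"
    and q: "quad_form n P y / N \<le> \<theta>"
  obtains Q where "psd_mat n Q" "right_inverse_mat n (\<lambda>i j. H i j + - (1 / N) * y i * y j) Q"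
    "trace_mat n Q \<le> trace_mat n P + quad_form n (gram_mat n P) y / (N * (1 - \<theta>))"
proof -
  define q where "q = quad_form n P y / N"
  have q: "q \<le> \<theta>" "q < 1" using q \<theta>_bounds by (simp_all add: q_def)
  have q0: "q \<ge> 0" using psd N_ge_1 by (simp add: q_def psd_mat_def)
  have pos: "1 + - (1 / N) * quad_form n P y > 0" using q by (simp add: q_def)
  note SM = Sherman_Morrison[OF psd inv pos]
  let ?Q = "\<lambda>i j. P i j - - (1 / N) / (1 + - (1 / N) * quad_form n P y) * mat_vec n P y i * mat_vec n P y j"
  have "trace_mat n ?Q = trace_mat n P + quad_form n (gram_mat n P) y * (1 / (N * (1 - q)))"
    unfolding SM(3) sum_mat_vec_squares by (simp add: q_def)
  also have "\<dots> \<le> trace_mat n P + quad_form n (gram_mat n P) y * (1 / (N * (1 - \<theta>)))"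
  proof (intro add_left_mono mult_left_mono)
    show "0 \<le> quad_form n (gram_mat n P) y" using psd_gram_mat[of n P] by (simp add: psd_mat_def)
    have "N * (1 - \<theta>) \<le> N * (1 - q)" using q N_ge_1 by (intro mult_left_mono) auto
    moreover have "0 < N * (1 - \<theta>)" using N_ge_1 \<theta>_bounds by simp
    ultimately show "1 / (N * (1 - q)) \<le> 1 / (N * (1 - \<theta>))" by (intro divide_left_mono) auto
  qed
  finally show ?thesis using that[of ?Q] SM(1,2) by simp
qed

text \<open>The term of row \<open>k\<close> moves to the right-hand side as a rank-one change of
  \<open>H\<close>, and the part \<open>\<delta>\<close> of the reserve becomes an actual shift of
  the diagonal.\<close>

lemma barrier_crossed_upd:
  assumes "k < n" 
  shows "x(k := y) \<in> barrier_crossed k H (\<delta> + t) \<longleftrightarrow>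
    x \<in> barrier_crossed (Suc k) (\<lambda>i j. H i j + (if i = j then \<delta> else 0) + - (1 / N) * y i * y j) t"
proof -
  have "{k..<n} = insert k {Suc k..<n}" using assms by auto
  hence "(\<Sum>i=k..<n. (\<Sum>j<n. (x(k := y)) i j * w j)\<^sup>2 / N) =
      (\<Sum>j<n. y j * w j)\<^sup>2 / N + (\<Sum>i=Suc k..<n. (\<Sum>j<n. x i j * w j)\<^sup>2 / N)" for w
    by simp
  thus ?thesis
    unfolding barrier_crossed_def quad_form_shift_rank_one by (simp add: algebra_simps)
qed

text \<open>Backward induction over the rows. The state consists of the certificate \<open>Q\<close>
  for \<open>H\<close>, the count \<open>b\<close> and the martingale value \<open>M\<close>; the
  invariant is that the trace plus the charges is at most \<open>n / 2 + M\<close>. With no row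
  left, the certificate makes the event empty.\<close>

lemma crossing_probability:
  assumes "k \<le> n" "psd_mat n Q" "right_inverse_mat n H Q" "sym_mat n H"
    "b \<ge> 0" "b \<le> Bmax" "trace_mat n Q + K * b \<le> real n / 2 + M"
  shows "measure_pmf.prob (Pi_pmf {k..<n} (\<lambda>_. 0) row) (barrier_crossed k H (shift_left k b))
    \<le> risk_bound k b M"
  using assms
proof (induction arbitrary: Q H b M rule: inc_induct)
  case base
  have "shift_left n b \<ge> 0" using base s by (simp add: shift_left_def)
  hence "barrier_crossed n H (shift_left n b) = {}"
    using quad_form_nonneg_of_psd_inverse[OF base(1-3)]
    by (auto simp: barrier_crossed_def not_less intro!: add_nonneg_nonneg mult_nonneg_nonneg sum_nonneg)
  thus ?case using base g2_nonneg by (simp add: risk_bound_def)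
next
  case (step k)
  have kn: "k < n" using step by simp
  have n0: "real n > 0" using n2 by simp
  have \<eta>n: "\<eta> * real n > 0" using \<eta> n0 by simp
  show ?case
  proof (cases "M \<ge> \<eta> * real n")
    case True
    hence "(\<eta> * real n)\<^sup>2 \<le> M\<^sup>2" using \<eta>n by (intro power_mono) auto
    hence "1 \<le> M\<^sup>2 / (\<eta> * real n)\<^sup>2" using \<eta> n0 by (simp add: le_divide_eq)
    moreover have "0 \<le> real (n - k) * g1 + (Bmax - b) * g2" using g1_nonneg g2_nonneg step.prems by simp
    ultimately have "1 \<le> risk_bound k b M" by (simp add: risk_bound_def)
    thus ?thesis using measure_pmf.prob_le_1 order_trans by blast
  next
    case False
    hence pot: "trace_mat n Q + K * b \<le> (1/2 + \<eta>) * real n"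
      using step.prems by (simp add: algebra_simps)
    obtain P b' where P: "psd_mat n P" "b' \<ge> 0" "b' \<le> Bmax"
      "right_inverse_mat n (\<lambda>i j. H i j + (if i = j then \<delta>0 + (b' - b) * (s / real n) else 0)) P"
      "trace_mat n P + \<delta>0 * frob2 n P + K * b' \<le> trace_mat n Q + K * b"
      "\<kappa> * (frob2 n P)\<^sup>2 \<le> g1 + (b' - b) * g2"
      using choose_shift[OF step.prems(1-3) pot step.prems(4)] by blast
    define \<delta> where "\<delta> = \<delta>0 + (b' - b) * (s / real n)"
    define H1 where "H1 = (\<lambda>i j. H i j + (if i = j then \<delta> else 0))"
    have H1: "sym_mat n H1" using step.prems(3) by (auto simp: sym_mat_def H1_def)
    have P4: "right_inverse_mat n H1 P" using P(4) unfolding H1_def \<delta>_def .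
    define G where "G = gram_mat n P"
    define X where "X = (\<lambda>y. quad_form n P y - measure_pmf.expectation (row k) (quad_form n P))"
    define Y where "Y = (\<lambda>y. quad_form n G y - measure_pmf.expectation (row k) (quad_form n G))"
    define Z where "Z = (\<lambda>y. Y y / (N * (1 - \<theta>)))"
    define rest where "rest = real (n - Suc k) * g1 + (Bmax - b') * g2"
    have rest0: "rest \<ge> 0" using g1_nonneg g2_nonneg P(3) by (simp add: rest_def)
    have sh: "shift_left k b = \<delta> + shift_left (Suc k) b'"
      using kn by (simp add: shift_left_def \<delta>_def Suc_diff_Suc[symmetric] algebra_simps diff_divide_distrib del: Suc_diff_Suc)
    define f where "f = (\<lambda>y. measure_pmf.prob (Pi_pmf {Suc k..<n} (\<lambda>_. 0) row)
        (barrier_crossed (Suc k) (\<lambda>i j. H1 i j + - (1 / N) * y i * y j) (shift_left (Suc k) b')))"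
    \<comment> \<open>Either row \<open>k\<close> stays below \<open>\<theta>\<close> and the
      induction hypothesis applies with \<open>M + Z y\<close>, or the fourth-power term alone is at
      least 1 and bounds any probability.\<close>
    have fb: "f y \<le> (X y)^4 / (N^4 * \<eta>^4) + (M + Z y)\<^sup>2 / (\<eta> * real n)\<^sup>2 + rest" for y
    proof (cases "quad_form n P y / N \<le> \<theta>")
      case True
      obtain Q' where Q': "psd_mat n Q'" "right_inverse_mat n (\<lambda>i j. H1 i j + - (1 / N) * y i * y j) Q'"
        "trace_mat n Q' \<le> trace_mat n P + quad_form n G y / (N * (1 - \<theta>))"
        using rank_one_step[OF P(1) P4 H1 True] unfolding G_def by blast
      have "measure_pmf.expectation (row k) (quad_form n G) \<le> frob2 n P"
        using expectation_row_psd[OF kn psd_gram_mat, of P] by (simp add: G_def trace_gram_mat)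
      \<comment> \<open>The mean part of the growth is offset by the drop in \<open>P(5)\<close>;
        only the centered part \<open>Z y\<close> enters the martingale.\<close>
      hence "quad_form n G y / (N * (1 - \<theta>)) \<le> Z y + \<delta>0 * frob2 n P"
        using N_ge_1 \<theta>_bounds by (simp add: Z_def Y_def \<delta>0_def divide_simps)
      hence "trace_mat n Q' + K * b' \<le> real n / 2 + (M + Z y)"
        using Q'(3) P(5) step.prems(6) by simp
      moreover have "sym_mat n (\<lambda>i j. H1 i j + - (1 / N) * y i * y j)"
        using H1 by (auto simp: sym_mat_def)
      ultimately have "f y \<le> risk_bound (Suc k) b' (M + Z y)"
        unfolding f_def using step.IH[OF Q'(1,2) _ P(2,3)] by blast
      moreover have "0 \<le> (X y)^4 / (N^4 * \<eta>^4)" using N_ge_1 \<eta> by simp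
      ultimately show ?thesis unfolding risk_bound_def rest_def by linarith
    next
      case False
      have "trace_mat n P \<le> (1/2 + \<eta>) * real n"
      proof -
        have "0 \<le> \<delta>0 * frob2 n P" "0 \<le> K * b'" using \<delta>0_pos frob2_nonneg[of n P] K P(2) by auto
        thus ?thesis using P(5) pot by linarith
      qed
      hence "measure_pmf.expectation (row k) (quad_form n P) / N \<le> (1/2 + \<eta>) * real n / N"
        using expectation_row_psd[OF kn P(1)] N_ge_1 by (intro divide_right_mono) auto
      also have "\<dots> \<le> \<theta> - \<eta>" using nN by (simp add: \<theta>_def N_def)
      finally have "\<eta> \<le> X y / N" using False by (simp add: X_def diff_divide_distrib)
      hence "\<eta> * N \<le> X y" using N_ge_1 by (simp add: field_simps)
      moreover have "0 \<le> \<eta> * N" using \<eta> N_ge_1 by simp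
      ultimately have "(\<eta> * N)^4 \<le> (X y)^4" by (rule power_mono)
      hence "1 \<le> (X y)^4 / (N^4 * \<eta>^4)" using N_ge_1 \<eta> by (simp add: power_mult_distrib mult.commute)
      moreover have "f y \<le> 1" unfolding f_def by simp
      moreover have "0 \<le> (M + Z y)\<^sup>2 / (\<eta> * real n)\<^sup>2" by simp
      ultimately show ?thesis using rest0 by linarith
    qed
    note [simp] = integrable_measure_pmf_finite[OF finite_row[OF kn]]
    have EX: "measure_pmf.expectation (row k) (\<lambda>y. (X y)^4) \<le> C * (frob2 n P)\<^sup>2"
      unfolding X_def using P(1) by (intro fourth_moment kn) (simp add: psd_mat_def)
    \<comment> \<open>For the martingale a variance suffices; it is obtained from the fourth moment
      by Cauchy-Schwarz against the constant 1.\<close>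
    have EY: "measure_pmf.expectation (row k) (\<lambda>y. (Y y)\<^sup>2) \<le> C * (frob2 n P)\<^sup>2"
    proof (rule power2_le_imp_le)
      have "(measure_pmf.expectation (row k) (\<lambda>y. (Y y)\<^sup>2 * 1))\<^sup>2 \<le>
          measure_pmf.expectation (row k) (\<lambda>y. ((Y y)\<^sup>2)\<^sup>2) * measure_pmf.expectation (row k) (\<lambda>y. 1\<^sup>2)"
        by (rule expectation_Cauchy_Schwarz[OF finite_row[OF kn]])
      also have "\<dots> = measure_pmf.expectation (row k) (\<lambda>y. (Y y)^4)" by simp
      also have "\<dots> \<le> C * (frob2 n G)\<^sup>2"
        unfolding Y_def by (intro fourth_moment kn) (simp add: G_def sym_gram_mat)
      also have "\<dots> \<le> C\<^sup>2 * ((frob2 n P)\<^sup>2)\<^sup>2"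
        using C_ge_1 frob2_gram_mat[of n P] frob2_nonneg[of n G] unfolding G_def
        by (intro mult_mono power_mono) (auto simp: power2_eq_square)
      finally show "(measure_pmf.expectation (row k) (\<lambda>y. (Y y)\<^sup>2))\<^sup>2 \<le> (C * (frob2 n P)\<^sup>2)\<^sup>2"
        by (simp add: power_mult_distrib)
    qed (use C_ge_1 in auto)
    have EZ: "measure_pmf.expectation (row k) Z = 0"
      by (simp add: Z_def[abs_def] Y_def)
    have EZ2: "measure_pmf.expectation (row k) (\<lambda>y. (Z y)\<^sup>2) \<le> C * (frob2 n P)\<^sup>2 / (N\<^sup>2 * (1 - \<theta>)\<^sup>2)"
      using EY N_ge_1 \<theta>_bounds by (simp add: Z_def power_divide power_mult_distrib divide_right_mono)
    have "measure_pmf.prob (Pi_pmf {k..<n} (\<lambda>_. 0) row) (barrier_crossed k H (shift_left k b)) =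
        measure_pmf.expectation (row k) f"
    proof -
      have ins: "{k..<n} = insert k {Suc k..<n}" using kn by auto
      have "measure_pmf.prob (Pi_pmf {k..<n} (\<lambda>_. 0) row) (barrier_crossed k H (shift_left k b)) =
        measure_pmf.expectation (Pi_pmf (insert k {Suc k..<n}) (\<lambda>_. 0) row)
          (indicator (barrier_crossed k H (shift_left k b)))" unfolding ins by simp
      also have "\<dots> = measure_pmf.expectation (row k) (\<lambda>y. measure_pmf.expectation
          (Pi_pmf {Suc k..<n} (\<lambda>_. 0) row) (\<lambda>x. indicator (barrier_crossed k H (shift_left k b)) (x(k := y))))"
        using finite_row kn by (subst expectation_Pi_pmf_insert(1)) auto
      also have "(\<lambda>y x. indicator (barrier_crossed k H (shift_left k b)) (x(k := y)) :: real) =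
        (\<lambda>y. indicator (barrier_crossed (Suc k) (\<lambda>i j. H1 i j + - (1 / N) * y i * y j) (shift_left (Suc k) b')))"
        unfolding sh H1_def by (intro ext) (simp add: indicator_def barrier_crossed_upd[OF kn])
      finally show ?thesis by (simp add: f_def)
    qed
    also have "\<dots> \<le> measure_pmf.expectation (row k)
        (\<lambda>y. (X y)^4 / (N^4 * \<eta>^4) + (M + Z y)\<^sup>2 / (\<eta> * real n)\<^sup>2 + rest)"
      by (intro expectation_mono_finite finite_row kn fb)
    \<comment> \<open>Since \<open>Z\<close> is centered the cross term vanishes, so
      \<open>M^2\<close> grows only by the variance of \<open>Z\<close>.\<close>
    also have "\<dots> = measure_pmf.expectation (row k) (\<lambda>y. (X y)^4) / (N^4 * \<eta>^4)
        + (M\<^sup>2 + measure_pmf.expectation (row k) (\<lambda>y. (Z y)\<^sup>2)) / (\<eta> * real n)\<^sup>2 + rest"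
      using EZ by (simp add: power2_sum)
    also have "\<dots> \<le> C * (frob2 n P)\<^sup>2 / (N^4 * \<eta>^4)
        + (M\<^sup>2 + C * (frob2 n P)\<^sup>2 / (N\<^sup>2 * (1 - \<theta>)\<^sup>2)) / (\<eta> * real n)\<^sup>2 + rest"
      using EX EZ2 N_ge_1 \<eta> by (intro add_mono divide_right_mono) auto
    also have "\<dots> = M\<^sup>2 / (\<eta> * real n)\<^sup>2 + \<kappa> * (frob2 n P)\<^sup>2 + rest"
      by (simp add: \<kappa>_def algebra_simps add_divide_distrib)
    also have "\<dots> \<le> M\<^sup>2 / (\<eta> * real n)\<^sup>2 + (g1 + (b' - b) * g2) + rest" using P(6) by simp
    also have "\<dots> = risk_bound k b M"
      using kn by (simp add: risk_bound_def rest_def Suc_diff_Suc[symmetric] algebra_simps del: Suc_diff_Suc)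
    finally show ?thesis .
  qed
qed

lemma norm_bound_probability:
  "measure_pmf.prob (Pi_pmf {..<n} (\<lambda>_. 0) row)
     {x. \<exists>w. (\<Sum>i<n. (\<Sum>j<n. x i j * w j)\<^sup>2 / N)
        > (2 + real n * \<delta>0 + Bmax * (s / real n)) * (\<Sum>j<n. (w j)\<^sup>2)}
   \<le> real n * g1 + Bmax * g2"
proof -
  \<comment> \<open>Start with no rows: barrier at 2, resolvent half the identity, potential exactly
    \<open>n / 2\<close>.\<close>
  define H where "H = (\<lambda>i j :: nat. if i = j then 2 else 0 :: real)"
  define Q where "Q = (\<lambda>i j :: nat. if i = j then 1/2 else 0 :: real)"
  have qf: "quad_form n (\<lambda>i j. if i = j then t else 0) x = t * (\<Sum>i<n. (x i)\<^sup>2)" for t x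
    using quad_form_shift_rank_one[of n "\<lambda>_ _. 0" t 0 "\<lambda>_. 0" x] by (simp add: quad_form_def)
  have "psd_mat n Q" unfolding psd_mat_def Q_def qf
    by (auto simp: sym_mat_def intro!: sum_nonneg divide_nonneg_nonneg)
  moreover have "sym_mat n H" by (simp add: sym_mat_def H_def)
  moreover have "right_inverse_mat n H Q"
  proof -
    have "(\<Sum>k<n. H i k * Q k j) = (\<Sum>k<n. if i = k then (if i = j then 1 else 0) else 0)" for i j
      by (intro sum.cong) (auto simp: H_def Q_def)
    thus ?thesis by (simp add: right_inverse_mat_def)
  qed
  moreover have "trace_mat n Q + K * 0 \<le> real n / 2 + 0" by (simp add: trace_mat_def Q_def)
  moreover have "0 \<le> Bmax" using K by (simp add: Bmax_def)
  ultimately have "measure_pmf.prob (Pi_pmf {0..<n} (\<lambda>_. 0) row) (barrier_crossed 0 H (shift_left 0 0))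
      \<le> risk_bound 0 0 0"
    by (intro crossing_probability[where Q = Q]) auto
  moreover have "barrier_crossed 0 H (shift_left 0 0) = {x. \<exists>w. (\<Sum>i<n. (\<Sum>j<n. x i j * w j)\<^sup>2 / N)
        > (2 + real n * \<delta>0 + Bmax * (s / real n)) * (\<Sum>j<n. (w j)\<^sup>2)}"
    unfolding barrier_crossed_def H_def qf
    by (simp add: shift_left_def algebra_simps lessThan_atLeast0)
  ultimately show ?thesis by (simp add: risk_bound_def lessThan_atLeast0)
qed

end

section \<open>Entries of the normalized residual matrix\<close>

text \<open>Functions of disjoint blocks of independent coordinates are independent. The last
  hypothesis says that \<open>h i\<close> reads only its own block; \<open>d\<close> outside
  \<open>I\<close> matches the default value of \<open>Pi_pmf\<close>.\<close>

lemma map_Pi_pmf_grouped: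
  assumes "finite I" "\<And>i. i \<in> I \<Longrightarrow> finite (S i)" "disjoint_family_on S I"
    and "\<And>i f g. i \<in> I \<Longrightarrow> (\<And>x. x \<in> S i \<Longrightarrow> f x = g x) \<Longrightarrow> h i f = h i g"
  shows "map_pmf (\<lambda>f i. if i \<in> I then h i f else d) (Pi_pmf (\<Union>i\<in>I. S i) dflt p) =
    Pi_pmf I d (\<lambda>i. map_pmf (h i) (Pi_pmf (S i) dflt p))"
  using assms
proof (induction I rule: finite_induct)
  case empty
  show ?case by simp
next
  case (insert a I)
  define U where "U = (\<Union>i\<in>I. S i)"
  have U: "finite U" using insert.prems(1) insert.hyps by (simp add: U_def)
  have disj: "S a \<inter> S i = {}" if "i \<in> I" for i
    using insert.prems(2) insert.hyps(2) that by (intro disjoint_family_onD[of S "insert a I"]) auto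
  hence SU: "S a \<inter> U = {}" by (auto simp: U_def)
  have IH: "map_pmf (\<lambda>f i. if i \<in> I then h i f else d) (Pi_pmf U dflt p) =
      Pi_pmf I d (\<lambda>i. map_pmf (h i) (Pi_pmf (S i) dflt p))"
    unfolding U_def
  proof (rule insert.IH)
    show "disjoint_family_on S I" using insert.prems(2) by (rule disjoint_family_on_mono[rotated]) auto
  qed (use insert.prems(1,3) in blast)+
  have eq: "(if i \<in> insert a I then h i (\<lambda>x. if x \<in> S a then f x else g x) else d) =
      ((\<lambda>i. if i \<in> I then h i g else d)(a := h a f)) i" for f g i
  proof (cases "i \<in> I")
    case True
    have "h i (\<lambda>x. if x \<in> S a then f x else g x) = h i g"
      using True disj[OF True] by (intro insert.prems(3)) auto
    moreover have "i \<noteq> a" using True insert.hyps by auto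
    ultimately show ?thesis using True by simp
  next
    case False
    have "h a (\<lambda>x. if x \<in> S a then f x else g x) = h a f" by (intro insert.prems(3)) auto
    thus ?thesis using False by simp
  qed
  have "map_pmf (\<lambda>f i. if i \<in> insert a I then h i f else d) (Pi_pmf (\<Union>i\<in>insert a I. S i) dflt p) =
    map_pmf (\<lambda>(f, g). (\<lambda>i. if i \<in> I then h i g else d)(a := h a f))
      (pair_pmf (Pi_pmf (S a) dflt p) (Pi_pmf U dflt p))"
  proof -
    have "(\<Union>i\<in>insert a I. S i) = S a \<union> U" by (simp add: U_def)
    hence "Pi_pmf (\<Union>i\<in>insert a I. S i) dflt p = map_pmf (\<lambda>(f, g) x. if x \<in> S a then f x else g x)
        (pair_pmf (Pi_pmf (S a) dflt p) (Pi_pmf U dflt p))"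
      using U SU insert.prems(1) by (simp add: Pi_pmf_union)
    thus ?thesis by (simp only: pmf.map_comp o_def case_prod_unfold eq)
  qed
  also have "\<dots> = Pi_pmf (insert a I) d (\<lambda>i. map_pmf (h i) (Pi_pmf (S i) dflt p))"
    using insert.hyps
    by (subst Pi_pmf_insert) (simp_all add: IH[symmetric] pair_map_pmf1 pair_map_pmf2 pmf.map_comp o_def
        case_prod_unfold)
  finally show ?case .
qed

section \<open>Moments and tails of centered Bernoulli sums\<close>

lemma bernoulli_mgf:
  fixes q r :: real
  assumes "0 \<le> q" "q \<le> 1"
  shows "q * exp (r * (1 - q)) + (1 - q) * exp (- r * q) \<le> exp (r\<^sup>2 / 8)"
proof -
  have *: "p * exp (h * (1 - p)) + (1 - p) * exp (- h * p) \<le> exp (h\<^sup>2 / 8)"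
    if "h \<ge> 0" "0 \<le> p" "p \<le> 1" for h p :: real
  proof -
    have pos: "1 + p * (exp h - 1) > 0"
      using that by (intro add_pos_nonneg mult_nonneg_nonneg) auto
    have "exp (- h * p + ln (1 + p * (exp h - 1))) \<le> exp (h\<^sup>2 / 8)"
      using Hoeffdings_lemma_aux[of h p] that by simp
    also have "exp (- h * p + ln (1 + p * (exp h - 1))) = exp (- h * p) * (1 + p * (exp h - 1))"
      unfolding exp_add using pos by simp
    also have "\<dots> = p * (exp (- h * p) * exp h) + (1 - p) * exp (- h * p)"
      by (simp add: algebra_simps)
    also have "exp (- h * p) * exp h = exp (h * (1 - p))"
      by (simp add: exp_add[symmetric] algebra_simps)
    finally show ?thesis .
  qed
  show ?thesis
  proof (cases "r \<ge> 0")
    case True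
    with * assms show ?thesis by blast
  next
    \<comment> \<open>A negative exponent reduces to a positive one by exchanging success and
      failure.\<close>
    case False
    with *[of "-r" "1 - q"] assms show ?thesis by (simp add: algebra_simps)
  qed
qed

text \<open>The eighth power of \<open>y / 8 \<le> exp (y / 8)\<close>. It derives eighth moments
  from the exponential moment, uniformly in the number of layers and without expanding a
  sum.\<close>

lemma power8_le_exp: "(x::real)^8 \<le> 8^8 * (exp x + exp (- x))"
proof -
  have pos: "y^8 \<le> 8^8 * exp y" if "y \<ge> 0" for y :: real
  proof -
    have "(y / 8)^8 \<le> (exp (y / 8))^8"
    proof (rule power_mono)
      show "y / 8 \<le> exp (y / 8)" using exp_ge_add_one_self[of "y / 8"] by linarith
    qed (use that in simp)
    also have "\<dots> = exp y" by (simp add: exp_of_nat_mult[symmetric])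
    finally show ?thesis by (simp add: power_divide)
  qed
  have "x^8 = \<bar>x\<bar>^8" by (simp add: power_even_abs)
  also have "\<dots> \<le> 8^8 * exp \<bar>x\<bar>" by (rule pos) simp
  also have "exp \<bar>x\<bar> \<le> exp x + exp (- x)" by (cases "x \<ge> 0") auto
  finally show ?thesis by simp
qed

context
  fixes A :: "'a set" and q :: "'a \<Rightarrow> real"
  assumes finA: "finite A" and q01: "\<And>e. e \<in> A \<Longrightarrow> 0 \<le> q e \<and> q e \<le> 1"
begin

private lemma finP: "finite (set_pmf (Pi_pmf A False (\<lambda>e. bernoulli_pmf (q e))))"
  by (intro finite_set_Pi_pmf finA) simp

lemma centered_bernoulli_sum:
  defines "S \<equiv> \<lambda>A x. (\<Sum>e\<in>A. (if x e then 1 else 0) - q e)"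
  shows "measure_pmf.expectation (Pi_pmf A False (\<lambda>e. bernoulli_pmf (q e))) (S A) = 0"
    and "measure_pmf.expectation (Pi_pmf A False (\<lambda>e. bernoulli_pmf (q e))) (\<lambda>x. (S A x)\<^sup>2) =
      (\<Sum>e\<in>A. q e * (1 - q e))"
    and "measure_pmf.expectation (Pi_pmf A False (\<lambda>e. bernoulli_pmf (q e))) (\<lambda>x. exp (r * S A x)) \<le>
      exp (r\<^sup>2 * real (card A) / 8)"
proof -
  have "measure_pmf.expectation (Pi_pmf A False (\<lambda>e. bernoulli_pmf (q e))) (S A) = 0 \<and>
    measure_pmf.expectation (Pi_pmf A False (\<lambda>e. bernoulli_pmf (q e))) (\<lambda>x. (S A x)\<^sup>2) =
      (\<Sum>e\<in>A. q e * (1 - q e)) \<and>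
    measure_pmf.expectation (Pi_pmf A False (\<lambda>e. bernoulli_pmf (q e))) (\<lambda>x. exp (r * S A x)) \<le>
      exp (r\<^sup>2 * real (card A) / 8)"
    using finA q01
  proof (induction A rule: finite_induct)
    case empty
    show ?case by (simp add: S_def)
  next
    case (insert a A)
    define P where "P = Pi_pmf A False (\<lambda>e. bernoulli_pmf (q e))"
    have fin: "finite (set_pmf P)" unfolding P_def using insert by (intro finite_set_Pi_pmf) auto
    note [simp] = integrable_measure_pmf_finite[OF fin]
    have qa: "0 \<le> q a" "q a \<le> 1" using insert.prems by auto
    have IH: "measure_pmf.expectation P (S A) = 0"
      "measure_pmf.expectation P (\<lambda>x. (S A x)\<^sup>2) = (\<Sum>e\<in>A. q e * (1 - q e))"
      "measure_pmf.expectation P (\<lambda>x. exp (r * S A x)) \<le> exp (r\<^sup>2 * real (card A) / 8)"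
      using insert unfolding P_def by auto
    have upd: "S (insert a A) (x(a := y)) = ((if y then 1 else 0) - q a) + S A x" for x y
    proof -
      have "(\<Sum>e\<in>A. (if (x(a := y)) e then 1 else 0) - q e) = S A x"
        unfolding S_def using insert.hyps by (intro sum.cong) auto
      thus ?thesis unfolding S_def using insert.hyps by simp
    qed
    have E: "measure_pmf.expectation (Pi_pmf (insert a A) False (\<lambda>e. bernoulli_pmf (q e)))
        (\<lambda>x. g (S (insert a A) x)) =
      q a * measure_pmf.expectation P (\<lambda>x. g ((1 - q a) + S A x)) +
      (1 - q a) * measure_pmf.expectation P (\<lambda>x. g (- q a + S A x))" for g :: "real \<Rightarrow> real"
      using insert.hyps qa by (subst expectation_Pi_pmf_insert(1)) (auto simp: upd P_def mult.commute)
    have "measure_pmf.expectation (Pi_pmf (insert a A) False (\<lambda>e. bernoulli_pmf (q e))) (S (insert a A)) = 0"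
      using E[of "\<lambda>z. z"] IH(1) by (simp add: algebra_simps)
    moreover have "measure_pmf.expectation (Pi_pmf (insert a A) False (\<lambda>e. bernoulli_pmf (q e)))
        (\<lambda>x. (S (insert a A) x)\<^sup>2) = (\<Sum>e\<in>insert a A. q e * (1 - q e))"
      unfolding E[of "\<lambda>z. z\<^sup>2"] power2_sum using IH(1,2) insert.hyps by (simp add: algebra_simps power2_eq_square)
    moreover have "measure_pmf.expectation (Pi_pmf (insert a A) False (\<lambda>e. bernoulli_pmf (q e)))
        (\<lambda>x. exp (r * S (insert a A) x)) \<le> exp (r\<^sup>2 * real (card (insert a A)) / 8)"
    proof -
      have "measure_pmf.expectation (Pi_pmf (insert a A) False (\<lambda>e. bernoulli_pmf (q e)))
        (\<lambda>x. exp (r * S (insert a A) x)) =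
        (q a * exp (r * (1 - q a)) + (1 - q a) * exp (- r * q a))
          * measure_pmf.expectation P (\<lambda>x. exp (r * S A x))"
        unfolding E[of "\<lambda>z. exp (r * z)"] distrib_left exp_add by (simp add: algebra_simps)
      also have "\<dots> \<le> exp (r\<^sup>2 / 8) * exp (r\<^sup>2 * real (card A) / 8)"
        using IH(3) bernoulli_mgf[OF qa] by (intro mult_mono) auto
      also have "\<dots> = exp (r\<^sup>2 * real (card (insert a A)) / 8)"
        using insert.hyps by (simp add: exp_add[symmetric] algebra_simps add_divide_distrib)
      finally show ?thesis .
    qed
    ultimately show ?case by blast
  qed
  thus "measure_pmf.expectation (Pi_pmf A False (\<lambda>e. bernoulli_pmf (q e))) (S A) = 0"
    "measure_pmf.expectation (Pi_pmf A False (\<lambda>e. bernoulli_pmf (q e))) (\<lambda>x. (S A x)\<^sup>2) =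
      (\<Sum>e\<in>A. q e * (1 - q e))"
    "measure_pmf.expectation (Pi_pmf A False (\<lambda>e. bernoulli_pmf (q e))) (\<lambda>x. exp (r * S A x)) \<le>
      exp (r\<^sup>2 * real (card A) / 8)" by auto
qed

lemma bernoulli_sum_eighth_moment:
  assumes "\<sigma> > 0"
  shows "measure_pmf.expectation (Pi_pmf A False (\<lambda>e. bernoulli_pmf (q e)))
     (\<lambda>x. ((\<Sum>e\<in>A. (if x e then 1 else 0) - q e) / \<sigma>)^8) \<le> 2 * 8^8 * exp (real (card A) / (8 * \<sigma>\<^sup>2))"
proof -
  define P where "P = Pi_pmf A False (\<lambda>e. bernoulli_pmf (q e))"
  define S where "S = (\<lambda>x. (\<Sum>e\<in>A. (if x e then 1 else 0) - q e))"
  have fin: "finite (set_pmf P)" unfolding P_def by (rule finP)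
  note [simp] = integrable_measure_pmf_finite[OF fin]
  have "measure_pmf.expectation P (\<lambda>x. (S x / \<sigma>)^8) \<le>
      measure_pmf.expectation P (\<lambda>x. 8^8 * (exp (S x / \<sigma>) + exp (- (S x / \<sigma>))))"
    by (intro expectation_mono_finite fin power8_le_exp)
  also have "\<dots> = 8^8 * (measure_pmf.expectation P (\<lambda>x. exp ((1 / \<sigma>) * S x))
      + measure_pmf.expectation P (\<lambda>x. exp ((- 1 / \<sigma>) * S x)))" by simp
  also have "\<dots> \<le> 8^8 * (exp ((1 / \<sigma>)\<^sup>2 * real (card A) / 8) + exp ((- 1 / \<sigma>)\<^sup>2 * real (card A) / 8))"
    unfolding P_def S_def by (intro mult_left_mono add_mono centered_bernoulli_sum(3)) auto
  also have "\<dots> = 2 * 8^8 * exp (real (card A) / (8 * \<sigma>\<^sup>2))"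
    by (simp add: power_divide mult.commute)
  finally show ?thesis unfolding P_def S_def .
qed

lemma bernoulli_sum_tail:
  assumes m: "real (card A) \<le> m" "m > 0" and t: "t \<ge> 0"
  shows "measure_pmf.prob (Pi_pmf A False (\<lambda>e. bernoulli_pmf (q e)))
     {x. \<bar>\<Sum>e\<in>A. (if x e then 1 else 0) - q e\<bar> \<ge> t} \<le> 2 * exp (- 2 * t\<^sup>2 / m)"
proof -
  define P where "P = Pi_pmf A False (\<lambda>e. bernoulli_pmf (q e))"
  define S where "S = (\<lambda>x. (\<Sum>e\<in>A. (if x e then 1 else 0) - q e))"
  have fin: "finite (set_pmf P)" unfolding P_def by (rule finP)
  note [simp] = integrable_measure_pmf_finite[OF fin]
  \<comment> \<open>Minimizer of \<open>r^2 * m / 8 - r * t\<close>, the exponent in Chernoff's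
    bound.\<close>
  define r where "r = 4 * t / m"
  have r: "r \<ge> 0" using m t by (simp add: r_def)
  have one: "\<mu>\<^sup>2 * real (card A) / 8 - r * t \<le> - 2 * t\<^sup>2 / m" if "\<mu>\<^sup>2 = r\<^sup>2" for \<mu>
  proof -
    have "\<mu>\<^sup>2 * real (card A) \<le> r\<^sup>2 * m" unfolding that using m by (intro mult_left_mono) auto
    moreover have "r\<^sup>2 * m / 8 - r * t = - 2 * t\<^sup>2 / m"
      using m by (simp add: r_def field_simps power2_eq_square)
    ultimately show ?thesis by simp
  qed
  have "measure_pmf.prob P {x. \<bar>S x\<bar> \<ge> t} = measure_pmf.expectation P (indicator {x. \<bar>S x\<bar> \<ge> t})" by simp
  also have "\<dots> \<le> measure_pmf.expectation P (\<lambda>x. exp (- (r * t)) * (exp (r * S x) + exp (- r * S x)))"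
  proof (intro expectation_mono_finite fin)
    fix x
    show "indicator {x. \<bar>S x\<bar> \<ge> t} x \<le> exp (- (r * t)) * (exp (r * S x) + exp (- r * S x))"
    proof (cases "\<bar>S x\<bar> \<ge> t")
      case True
      have "1 \<le> exp (r * \<bar>S x\<bar> - r * t)" using True r by (simp add: mult_left_mono)
      also have "\<dots> = exp (- (r * t)) * exp (r * \<bar>S x\<bar>)" by (simp add: exp_add[symmetric])
      also have "\<dots> \<le> exp (- (r * t)) * (exp (r * S x) + exp (- r * S x))"
        by (intro mult_left_mono) (auto simp: abs_if)
      finally show ?thesis using True by simp
    qed simp
  qed
  also have "\<dots> = exp (- (r * t)) * (measure_pmf.expectation P (\<lambda>x. exp (r * S x))
      + measure_pmf.expectation P (\<lambda>x. exp (- r * S x)))" by simp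
  also have "\<dots> \<le> exp (- (r * t)) * (exp (r\<^sup>2 * real (card A) / 8) + exp ((- r)\<^sup>2 * real (card A) / 8))"
    unfolding P_def S_def by (intro mult_left_mono add_mono centered_bernoulli_sum(3)) auto
  also have "\<dots> = exp (r\<^sup>2 * real (card A) / 8 - r * t) + exp ((- r)\<^sup>2 * real (card A) / 8 - r * t)"
    by (simp add: distrib_left exp_add[symmetric])
  also have "\<dots> \<le> exp (- 2 * t\<^sup>2 / m) + exp (- 2 * t\<^sup>2 / m)"
    using one[of r] one[of "-r"] by (intro add_mono) auto
  finally show ?thesis unfolding P_def S_def by simp
qed

end

text \<open>The factor \<open>1 / sqrt (n - 1)\<close> is left out, so off-diagonal entries have
  variance 1, as the barrier argument expects.\<close>

definition ideal_entry :: "nat \<Rightarrow> (nat \<Rightarrow> nat) \<Rightarrow> (nat \<Rightarrow> nat) \<Rightarrow> (nat \<Rightarrow> nat \<Rightarrow> nat \<Rightarrow> real)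
    \<Rightarrow> network \<Rightarrow> nat \<Rightarrow> nat \<Rightarrow> real" where
  "ideal_entry L gs gr B x i j = (if i = j then 0 else
     (\<Sum>l<L. adj x l i j - B l (gs i) (gr j)) / sqrt (\<Sum>l<L. B l (gs i) (gr j) * (1 - B l (gs i) (gr j))))"

section \<open>The block model at fixed \<open>n\<close>: law and moments of the normalized
  entries\<close>

locale sbm =
  fixes n L Ks Kr :: nat and gs gr :: "nat \<Rightarrow> nat" and B :: "nat \<Rightarrow> nat \<Rightarrow> nat \<Rightarrow> real" and \<delta> :: real
  assumes L_pos: "L \<ge> 1"
    and gs_range: "\<And>i. i < n \<Longrightarrow> gs i < Ks"
    and gr_range: "\<And>j. j < n \<Longrightarrow> gr j < Kr"
    and \<delta>: "0 < \<delta>" "\<delta> < 1/2"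
    and B_range: "\<And>l k m. l < L \<Longrightarrow> k < Ks \<Longrightarrow> m < Kr \<Longrightarrow> \<delta> \<le> B l k m \<and> B l k m \<le> 1 - \<delta>"
begin

text \<open>The coordinates that entry \<open>(i, j)\<close> depends on. Empty on the diagonal,
  where the model has no coordinate and the entry is constantly 0.\<close>

definition fiber :: "nat \<Rightarrow> nat \<Rightarrow> (nat \<times> nat \<times> nat) set" where
  "fiber i j = (if i = j then {} else (\<lambda>l. (l, i, j)) ` {..<L})"

definition edge_prob :: "nat \<times> nat \<times> nat \<Rightarrow> real" where
  "edge_prob = (\<lambda>(l, i, j). B l (gs i) (gr j))"

definition variance_sum :: "nat \<Rightarrow> nat \<Rightarrow> real" where
  "variance_sum i j = (\<Sum>l<L. B l (gs i) (gr j) * (1 - B l (gs i) (gr j)))"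

definition entry_pmf :: "nat \<Rightarrow> nat \<Rightarrow> real pmf" where
  "entry_pmf i j = map_pmf (\<lambda>x. ideal_entry L gs gr B x i j)
     (Pi_pmf (fiber i j) False (\<lambda>e. bernoulli_pmf (edge_prob e)))"

lemma B_bounds:
  assumes "i < n" "j < n" "l < L"
  shows "\<delta> \<le> B l (gs i) (gr j)" "B l (gs i) (gr j) \<le> 1 - \<delta>"
  using B_range[OF assms(3) gs_range[OF assms(1)] gr_range[OF assms(2)]] by auto

lemma mlscbm_alt: "mlscbm n L gs gr B = Pi_pmf (entries n L) False (\<lambda>e. bernoulli_pmf (edge_prob e))"
  unfolding mlscbm_def edge_prob_def by (rule arg_cong[where f = "Pi_pmf _ _"]) auto

lemma entries_eq: "entries n L = (\<Union>i<n. \<Union>j<n. fiber i j)"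
  by (auto simp: entries_def fiber_def)

lemma finite_fiber: "finite (fiber i j)" by (simp add: fiber_def)

lemma finite_entries: "finite (entries n L)"
  unfolding entries_eq by (auto simp: finite_fiber)

lemma edge_prob_entries: "e \<in> entries n L \<Longrightarrow> \<delta> \<le> edge_prob e \<and> edge_prob e \<le> 1 - \<delta>"
  using B_bounds by (auto simp: entries_def edge_prob_def)

text \<open>Grouping twice, first into rows and then into the fibers of a row. The matrix is cut off
  outside \<open>n\<close> by \<open>n\<close> because a product measure takes its default value
  there.\<close>

lemma matrix_distribution:
  "map_pmf (\<lambda>x i. if i \<in> {..<n} then (\<lambda>j. if j \<in> {..<n} then ideal_entry L gs gr B x i j else 0) else (\<lambda>_. 0))
     (mlscbm n L gs gr B) = Pi_pmf {..<n} (\<lambda>_. 0) (\<lambda>i. Pi_pmf {..<n} 0 (entry_pmf i))"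
proof -
  have dep: "ideal_entry L gs gr B x i j = ideal_entry L gs gr B y i j"
    if "\<And>e. e \<in> fiber i j \<Longrightarrow> x e = y e" for x y i j
  proof (cases "i = j")
    case False
    hence "adj x l i j = adj y l i j" if "l < L" for l
      using that \<open>\<And>e. e \<in> fiber i j \<Longrightarrow> x e = y e\<close> by (auto simp: adj_def fiber_def)
    thus ?thesis by (simp add: ideal_entry_def)
  qed (simp add: ideal_entry_def)
  have "map_pmf (\<lambda>x i. if i \<in> {..<n} then (\<lambda>j. if j \<in> {..<n} then ideal_entry L gs gr B x i j else 0) else (\<lambda>_. 0))
     (mlscbm n L gs gr B) =
    Pi_pmf {..<n} (\<lambda>_. 0) (\<lambda>i. map_pmf (\<lambda>x j. if j \<in> {..<n} then ideal_entry L gs gr B x i j else 0)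
      (Pi_pmf (\<Union>j<n. fiber i j) False (\<lambda>e. bernoulli_pmf (edge_prob e))))"
    unfolding mlscbm_alt entries_eq
  proof (intro map_Pi_pmf_grouped)
    show "disjoint_family_on (\<lambda>i. \<Union>j<n. fiber i j) {..<n}"
      by (auto simp: disjoint_family_on_def fiber_def)
    show "(\<lambda>j. if j \<in> {..<n} then ideal_entry L gs gr B f i j else 0) =
        (\<lambda>j. if j \<in> {..<n} then ideal_entry L gs gr B g i j else 0)"
      if "\<And>x. x \<in> (\<Union>j<n. fiber i j) \<Longrightarrow> f x = g x" for i f g
      using that by (intro ext if_cong refl dep) auto
  qed (auto simp: finite_fiber)
  also have "(\<lambda>i. map_pmf (\<lambda>x j. if j \<in> {..<n} then ideal_entry L gs gr B x i j else 0)
      (Pi_pmf (\<Union>j<n. fiber i j) False (\<lambda>e. bernoulli_pmf (edge_prob e)))) =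
    (\<lambda>i. Pi_pmf {..<n} 0 (entry_pmf i))"
    unfolding entry_pmf_def
    by (intro ext map_Pi_pmf_grouped dep)
      (auto simp: finite_fiber disjoint_family_on_def fiber_def split: if_splits)
  finally show ?thesis .
qed

lemma variance_sum_ge:
  assumes "i < n" "j < n"
  shows "variance_sum i j \<ge> real L * (\<delta> / 2)"
proof -
  have "\<delta> / 2 \<le> B l (gs i) (gr j) * (1 - B l (gs i) (gr j))" if "l < L" for l
  proof -
    have "\<delta> * (1 - \<delta>) \<le> B l (gs i) (gr j) * (1 - B l (gs i) (gr j))"
    proof -
      have "0 \<le> (B l (gs i) (gr j) - \<delta>) * (1 - \<delta> - B l (gs i) (gr j))"
        using B_bounds[OF assms that] by (intro mult_nonneg_nonneg) auto
      thus ?thesis by (simp add: algebra_simps)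
    qed
    moreover have "\<delta> * (1/2) \<le> \<delta> * (1 - \<delta>)" using \<delta> by (intro mult_left_mono) auto
    ultimately show ?thesis by simp
  qed
  hence "(\<Sum>l<L. \<delta> / 2) \<le> variance_sum i j" unfolding variance_sum_def by (intro sum_mono) auto
  thus ?thesis by simp
qed

lemma ideal_entry_fiber:
  assumes "i \<noteq> j"
  shows "ideal_entry L gs gr B x i j =
    (\<Sum>e\<in>fiber i j. (if x e then 1 else 0) - edge_prob e) / sqrt (variance_sum i j)"
  using assms by (simp add: ideal_entry_def fiber_def sum.reindex inj_on_def edge_prob_def adj_def variance_sum_def)

lemma entry_moments:
  assumes ij: "i < n" "j < n"
  shows "finite (set_pmf (entry_pmf i j))"
    and "measure_pmf.expectation (entry_pmf i j) (\<lambda>x. x) = 0"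
    and "measure_pmf.expectation (entry_pmf i j) (\<lambda>x. x\<^sup>2) \<le> 1"
    and "1 + measure_pmf.expectation (entry_pmf i j) (\<lambda>x. x^8) \<le> 1 + 2 * 8^8 * exp (1 / (4 * \<delta>))"
proof -
  have "finite (set_pmf (Pi_pmf (fiber i j) False (\<lambda>e. bernoulli_pmf (edge_prob e))))"
    by (intro finite_set_Pi_pmf finite_fiber) simp
  note fin = this
  thus "finite (set_pmf (entry_pmf i j))" by (simp add: entry_pmf_def)
  note [simp] = integrable_measure_pmf_finite[OF fin]
  have q: "0 \<le> edge_prob e \<and> edge_prob e \<le> 1" if "e \<in> fiber i j" for e
  proof -
    have "e \<in> entries n L" using that ij by (auto simp: entries_eq)
    thus ?thesis using edge_prob_entries[of e] \<delta> by auto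
  qed
  have "real L * (\<delta> / 2) > 0" using L_pos \<delta> by simp
  hence v: "variance_sum i j > 0" using variance_sum_ge[OF ij] by linarith
  have vs: "variance_sum i j = (\<Sum>e\<in>fiber i j. edge_prob e * (1 - edge_prob e))" if "i \<noteq> j"
    using that by (simp add: variance_sum_def fiber_def sum.reindex inj_on_def edge_prob_def)
  define P where "P = Pi_pmf (fiber i j) False (\<lambda>e. bernoulli_pmf (edge_prob e))"
  define S where "S = (\<lambda>x. \<Sum>e\<in>fiber i j. (if x e then 1 else 0) - edge_prob e)"
  note [simp] = integrable_measure_pmf_finite[OF fin, folded P_def]
  have entry: "measure_pmf.expectation (entry_pmf i j) g =
      measure_pmf.expectation P (\<lambda>x. g (S x / sqrt (variance_sum i j)))" if "i \<noteq> j" for g :: "real \<Rightarrow> real"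
    unfolding entry_pmf_def P_def S_def by (simp add: ideal_entry_fiber[OF that])
  have S: "measure_pmf.expectation P S = 0"
      "measure_pmf.expectation P (\<lambda>x. (S x)\<^sup>2) = (\<Sum>e\<in>fiber i j. edge_prob e * (1 - edge_prob e))"
    unfolding P_def S_def using finite_fiber q by (intro centered_bernoulli_sum; auto)+
  have "measure_pmf.expectation (entry_pmf i j) (\<lambda>x. x) = 0 \<and>
    measure_pmf.expectation (entry_pmf i j) (\<lambda>x. x\<^sup>2) \<le> 1 \<and>
    measure_pmf.expectation (entry_pmf i j) (\<lambda>x. x^8) \<le> 2 * 8^8 * exp (1 / (4 * \<delta>))"
  proof (cases "i = j")
    case True
    thus ?thesis by (simp add: entry_pmf_def ideal_entry_def)
  next
    case False
    have "measure_pmf.expectation (entry_pmf i j) (\<lambda>x. x^8) \<le>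
        2 * 8^8 * exp (real (card (fiber i j)) / (8 * (sqrt (variance_sum i j))\<^sup>2))"
      unfolding entry[OF False] unfolding P_def S_def
      using finite_fiber q v by (intro bernoulli_sum_eighth_moment) auto
    also have "card (fiber i j) = L"
      using False by (simp add: fiber_def card_image inj_on_def)
    \<comment> \<open>Both sides of the quotient are linear in \<open>L\<close>, so the moment bound
      does not depend on the number of layers.\<close>
    also have "real L / (8 * (sqrt (variance_sum i j))\<^sup>2) \<le> 1 / (4 * \<delta>)"
      using variance_sum_ge[OF ij] v \<delta> by (simp add: field_simps)
    finally have "measure_pmf.expectation (entry_pmf i j) (\<lambda>x. x^8) \<le> 2 * 8^8 * exp (1 / (4 * \<delta>))"
      by simp
    moreover have "measure_pmf.expectation (entry_pmf i j) (\<lambda>x. x) = 0"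
      unfolding entry[OF False] using S(1) by simp
    moreover have "measure_pmf.expectation (entry_pmf i j) (\<lambda>x. x\<^sup>2) \<le> 1"
      unfolding entry[OF False] using S(2) v by (simp add: power_divide vs[OF False])
    ultimately show ?thesis by blast
  qed
  thus "measure_pmf.expectation (entry_pmf i j) (\<lambda>x. x) = 0"
    "measure_pmf.expectation (entry_pmf i j) (\<lambda>x. x\<^sup>2) \<le> 1"
    "1 + measure_pmf.expectation (entry_pmf i j) (\<lambda>x. x^8) \<le> 1 + 2 * 8^8 * exp (1 / (4 * \<delta>))"
    by auto
qed

end

section \<open>Estimated block means\<close>

text \<open>A permutation of labels is injective, so each node keeps its set of community members,
  and the block mean at a node's own labels depends on these sets only.\<close>

lemma Rhat_labels_equiv:
  assumes s: "labels_equiv n Ks gh gs" and r: "labels_equiv n Kr gh' gr"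
    and gs: "\<And>i. i < n \<Longrightarrow> gs i < Ks" and gr: "\<And>j. j < n \<Longrightarrow> gr j < Kr"
    and ij: "i < n" "j < n"
  shows "Rhat n L x gh gh' i j = Rhat n L x gs gr i j"
proof -
  have fiber: "{i'. i' < n \<and> h i' = h i} = {i'. i' < n \<and> g i' = g i}"
    if equiv: "labels_equiv n K h g" and range: "\<And>i. i < n \<Longrightarrow> g i < K" and i: "i < n" for K h g i
  proof -
    obtain p where p: "bij_betw p {..<K} {..<K}" "\<And>i. i < n \<Longrightarrow> h i = p (g i)"
      using equiv unfolding labels_equiv_def by blast
    have "h i' = h i \<longleftrightarrow> g i' = g i" if "i' < n" for i'
      using inj_on_eq_iff[OF bij_betw_imp_inj_on[OF p(1)], of "g i'" "g i"] range i that
      by (simp add: p(2))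
    thus ?thesis by auto
  qed
  have "Bhat n x gh gh' l (gh i) (gh' j) = Bhat n x gs gr l (gs i) (gr j)" for l
    using fiber[OF s gs ij(1)] fiber[OF r gr ij(2)] by (simp only: Bhat_def)
  hence "Omegahat n x gh gh' l i j = Omegahat n x gs gr l i j" for l
    by (simp add: Omegahat_def)
  thus ?thesis by (simp add: Rhat_def)
qed

text \<open>\<open>a\<close> and \<open>s\<close> are the true numerator and variance sum,
  \<open>a + d\<close> and \<open>t\<close> the estimated ones. The trivial
  \<open>\<bar>a\<bar> \<le> L\<close> is affordable: with \<open>\<eta>\<close> of order
  \<open>K_max sqrt (ln n) / n\<close>, \<open>n\<close> times the bound is of order
  \<open>sqrt (K_max^2 L ln n / n)\<close>, the root of the quantity in Assumption 3.\<close>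

lemma normalization_perturbation:
  fixes a d s t N L \<eta> \<delta> :: real
  assumes L: "L > 0" and N: "N > 0" and \<delta>: "0 < \<delta>" "\<delta> < 1" and a: "\<bar>a\<bar> \<le> L"
    and d: "\<bar>d\<bar> \<le> L * \<eta>" and s: "s \<ge> L * (\<delta> / 4)" and t: "t \<ge> L * (\<delta> / 4)"
    and st: "\<bar>s - t\<bar> \<le> L * \<eta>" and \<eta>: "\<eta> \<ge> 0"
  shows "\<bar>(a + d) / sqrt (N * t) - a / sqrt s / sqrt N\<bar> \<le> sqrt (L / N) * \<eta> * (6 / \<delta>\<^sup>2)"
proof -
  define \<mu> where "\<mu> = sqrt L * sqrt \<delta> / 2"
  have \<mu>: "\<mu> > 0" using L \<delta> by (simp add: \<mu>_def)
  have "sqrt (L * (\<delta> / 4)) = \<mu>" by (simp add: \<mu>_def real_sqrt_mult real_sqrt_divide)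
  hence ge: "\<mu> \<le> sqrt s" "\<mu> \<le> sqrt t" using s t by (metis real_sqrt_le_iff)+
  have pos: "0 < sqrt s" "0 < sqrt t" using ge \<mu> by linarith+
  hence st0: "0 < s" "0 < t" by simp_all
  have diff: "\<bar>sqrt s - sqrt t\<bar> \<le> L * \<eta> / (2 * \<mu>)"
  proof -
    have "(sqrt s - sqrt t) * (sqrt s + sqrt t) = s - t" using st0 by (simp add: algebra_simps)
    hence "\<bar>sqrt s - sqrt t\<bar> * (sqrt s + sqrt t) = \<bar>s - t\<bar>"
      using pos by (metis abs_mult abs_of_pos add_pos_pos)
    moreover have "\<bar>sqrt s - sqrt t\<bar> * (2 * \<mu>) \<le> \<bar>sqrt s - sqrt t\<bar> * (sqrt s + sqrt t)"
      using ge by (intro mult_left_mono) auto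
    ultimately show ?thesis using st \<mu> by (simp add: pos_le_divide_eq)
  qed
  have "\<bar>(a + d) / sqrt t - a / sqrt s\<bar> \<le> \<bar>d\<bar> / sqrt t + \<bar>a\<bar> * \<bar>sqrt s - sqrt t\<bar> / (sqrt s * sqrt t)"
  proof -
    have "(a + d) / sqrt t - a / sqrt s = d / sqrt t + a * (sqrt s - sqrt t) / (sqrt s * sqrt t)"
      using pos by (simp add: field_simps)
    also have "\<bar>\<dots>\<bar> \<le> \<bar>d / sqrt t\<bar> + \<bar>a * (sqrt s - sqrt t) / (sqrt s * sqrt t)\<bar>" by (rule abs_triangle_ineq)
    finally show ?thesis using st0 by (simp add: abs_mult)
  qed
  also have "\<dots> \<le> L * \<eta> / \<mu> + L * (L * \<eta> / (2 * \<mu>)) / (\<mu> * \<mu>)"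
    using a d diff ge \<mu> L \<eta> st0 by (intro add_mono frac_le mult_mono) auto
  also have "\<dots> = sqrt L * \<eta> * (2 / sqrt \<delta> + 4 / (\<delta> * sqrt \<delta>))"
  proof -
    have L': "L = sqrt L * sqrt L" using L by simp
    have "L * \<eta> / \<mu> = sqrt L * \<eta> * (2 / sqrt \<delta>)"
      using L \<delta> by (subst L') (simp add: \<mu>_def field_simps)
    moreover have "L * (L * \<eta> / (2 * \<mu>)) / (\<mu> * \<mu>) = sqrt L * \<eta> * (4 / (\<delta> * sqrt \<delta>))"
    proof -
      have mm: "\<mu> * \<mu> = L * \<delta> / 4" using L \<delta> by (simp add: \<mu>_def field_simps)
      have "L * (L * \<eta> / (2 * \<mu>)) / (\<mu> * \<mu>) = L * (L * \<eta> / (2 * \<mu>)) / (L * \<delta> / 4)"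
        by (simp only: mm)
      also have "\<dots> = L * \<eta> / \<mu> * (2 / \<delta>)" using L \<delta> \<mu> by (simp add: field_simps)
      also have "L * \<eta> / \<mu> = sqrt L * \<eta> * (2 / sqrt \<delta>)" by fact
      finally show ?thesis by (simp add: field_simps)
    qed
    ultimately show ?thesis by (simp only: distrib_left)
  qed
  also have "\<dots> \<le> sqrt L * \<eta> * (6 / \<delta>\<^sup>2)"
  proof (rule mult_left_mono)
    have "\<delta> \<le> sqrt \<delta>" using \<delta> by (intro real_le_rsqrt) (simp add: power2_eq_square mult_left_le)
    hence 1: "\<delta> * \<delta> \<le> \<delta> * sqrt \<delta>" using \<delta> by (intro mult_left_mono) auto
    have "\<delta> * sqrt \<delta> \<le> 1 * sqrt \<delta>" using \<delta> by (intro mult_right_mono) auto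
    with 1 have 2: "\<delta> * \<delta> \<le> sqrt \<delta>" by simp
    have "2 / sqrt \<delta> \<le> 2 / (\<delta> * \<delta>)" "4 / (\<delta> * sqrt \<delta>) \<le> 4 / (\<delta> * \<delta>)"
      using 1 2 \<delta> by (intro divide_left_mono; simp)+
    thus "2 / sqrt \<delta> + 4 / (\<delta> * sqrt \<delta>) \<le> 6 / \<delta>\<^sup>2" by (simp add: power2_eq_square)
  qed (use L \<eta> in auto)
  finally have "\<bar>(a + d) / sqrt t - a / sqrt s\<bar> / sqrt N \<le> sqrt L * \<eta> * (6 / \<delta>\<^sup>2) / sqrt N"
    using N by (intro divide_right_mono) auto
  moreover have "(a + d) / sqrt (N * t) - a / sqrt s / sqrt N = ((a + d) / sqrt t - a / sqrt s) / sqrt N"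
    by (simp add: real_sqrt_mult diff_divide_distrib mult.commute)
  moreover have "sqrt L * \<eta> * (6 / \<delta>\<^sup>2) / sqrt N = sqrt (L / N) * \<eta> * (6 / \<delta>\<^sup>2)"
    by (simp add: real_sqrt_divide mult.commute)
  ultimately show ?thesis using N by simp
qed

text \<open>Triangle inequality, with the operator norm of \<open>R - X\<close> bounded by its
  Frobenius norm. The condition \<open>n > 0\<close> supplies a unit vector, so that the supremum is
  over a nonempty set.\<close>

lemma sigma1_perturbation:
  assumes n: "n > 0" and T: "T \<ge> 0"
    and X: "\<And>w. (\<Sum>i<n. (\<Sum>j<n. X i j * w j)\<^sup>2) \<le> T * (\<Sum>j<n. (w j)\<^sup>2)"
    and e: "\<And>i j. i < n \<Longrightarrow> j < n \<Longrightarrow> \<bar>R i j - X i j\<bar> \<le> e"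
  shows "sigma1 n R \<le> sqrt T + real n * e"
  unfolding sigma1_def
proof (rule cSup_least)
  have "(\<Sum>j<n. (if j = 0 then 1 else 0 :: real)\<^sup>2) = 1" 
    using n by (simp add: if_distrib[of "\<lambda>z. z\<^sup>2"] cong: if_cong)
  hence "sqrt (\<Sum>i<n. (\<Sum>j<n. R i j * (if j = 0 then 1 else 0))\<^sup>2) \<in>
      {sqrt (\<Sum>i<n. (\<Sum>j<n. R i j * v j)\<^sup>2) |v. (\<Sum>j<n. (v j)\<^sup>2) = 1}"
    by (intro CollectI exI[of _ "\<lambda>j. if j = 0 then 1 else 0"] conjI refl)
  thus "{sqrt (\<Sum>i<n. (\<Sum>j<n. R i j * v j)\<^sup>2) |v. (\<Sum>j<n. (v j)\<^sup>2) = 1} \<noteq> {}" by (metis empty_iff)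
next
  fix y assume "y \<in> {sqrt (\<Sum>i<n. (\<Sum>j<n. R i j * v j)\<^sup>2) |v. (\<Sum>j<n. (v j)\<^sup>2) = 1}"
  then obtain v where y: "y = sqrt (\<Sum>i<n. (\<Sum>j<n. R i j * v j)\<^sup>2)" and v: "(\<Sum>j<n. (v j)\<^sup>2) = 1"
    by blast
  have e0: "e \<ge> 0" using e[of 0 0] n by linarith
  define f where "f = (\<lambda>i. \<Sum>j<n. X i j * v j)"
  define g where "g = (\<lambda>i. \<Sum>j<n. (R i j - X i j) * v j)"
  have "y = L2_set (\<lambda>i. f i + g i) {..<n}"
    unfolding y L2_set_def f_def g_def by (simp add: sum.distrib[symmetric] algebra_simps)
  also have "\<dots> \<le> L2_set f {..<n} + L2_set g {..<n}" by (rule L2_set_triangle_ineq)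
  also have "L2_set f {..<n} \<le> sqrt T"
    unfolding L2_set_def f_def using X[of v] v by simp
  also have "L2_set g {..<n} \<le> real n * e"
  proof -
    have "(g i)\<^sup>2 \<le> real n * e\<^sup>2" if "i < n" for i
    proof -
      have "(g i)\<^sup>2 \<le> (\<Sum>j<n. (R i j - X i j)\<^sup>2) * (\<Sum>j<n. (v j)\<^sup>2)"
        unfolding g_def by (rule Cauchy_Schwarz_ineq_sum)
      also have "(\<Sum>j<n. (R i j - X i j)\<^sup>2) \<le> (\<Sum>j<n. e\<^sup>2)"
        using e[OF that] e0 by (intro sum_mono) (metis abs_le_square_iff abs_of_nonneg lessThan_iff)
      finally show ?thesis by (simp add: v)
    qed
    hence "(\<Sum>i<n. (g i)\<^sup>2) \<le> (\<Sum>i<n. real n * e\<^sup>2)" by (intro sum_mono) auto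
    also have "\<dots> = (real n * e)\<^sup>2" by (simp add: power2_eq_square)
    finally have "L2_set g {..<n} \<le> sqrt ((real n * e)\<^sup>2)" unfolding L2_set_def by (rule real_sqrt_le_mono)
    thus ?thesis using e0 by simp
  qed
  finally show "y \<le> sqrt T + real n * e" by simp
qed

context sbm
begin

text \<open>\<open>\<eta> \<le> \<delta> / 2\<close> keeps the estimated means within
  \<open>[\<delta>/2, 1 - \<delta>/2]\<close> and hence the estimated variance sum above
  \<open>L \<delta> / 4\<close>. As \<open>p * (1 - p)\<close> is 1-Lipschitz on the unit interval,
  the variance sums differ by at most \<open>L \<eta>\<close>.\<close>

lemma Rhat_near_ideal:
  assumes ij: "i < n" "j < n" and n: "n \<ge> 2" and \<eta>: "0 \<le> \<eta>" "\<eta> \<le> \<delta> / 2"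
    and B: "\<And>l. l < L \<Longrightarrow> \<bar>Bhat n x gs gr l (gs i) (gr j) - B l (gs i) (gr j)\<bar> \<le> \<eta>"
  shows "\<bar>Rhat n L x gs gr i j - ideal_entry L gs gr B x i j / sqrt (real n - 1)\<bar>
    \<le> sqrt (real L / (real n - 1)) * \<eta> * (6 / \<delta>\<^sup>2)"
proof (cases "i = j")
  case True
  thus ?thesis using \<eta> n by (simp add: Rhat_def ideal_entry_def)
next
  case False
  define p where "p = (\<lambda>l. B l (gs i) (gr j))"
  define p' where "p' = (\<lambda>l. Bhat n x gs gr l (gs i) (gr j))"
  define a where "a = (\<Sum>l<L. adj x l i j - p l)"
  define d where "d = (\<Sum>l<L. p l - p' l)"
  have close: "\<bar>p' l - p l\<bar> \<le> \<eta>" if "l < L" for l using B[OF that] by (simp add: p_def p'_def)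
  have p: "\<delta> \<le> p l" "p l \<le> 1 - \<delta>" if "l < L" for l using B_bounds[OF ij that] by (auto simp: p_def)
  have p': "\<delta> / 2 \<le> p' l" "p' l \<le> 1 - \<delta> / 2" if "l < L" for l
    using p[OF that] close[OF that] \<eta> by linarith+
  have "\<bar>a\<bar> \<le> (\<Sum>l<L. \<bar>adj x l i j - p l\<bar>)" unfolding a_def by (rule sum_abs)
  also have "\<dots> \<le> (\<Sum>l<L. 1)" using p \<delta> by (intro sum_mono) (force simp: adj_def)
  finally have a: "\<bar>a\<bar> \<le> real L" by simp
  have "\<bar>d\<bar> \<le> (\<Sum>l<L. \<bar>p l - p' l\<bar>)" unfolding d_def by (rule sum_abs)
  also have "\<dots> \<le> (\<Sum>l<L. \<eta>)" using close by (intro sum_mono) (simp add: abs_minus_commute)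
  finally have d: "\<bar>d\<bar> \<le> real L * \<eta>" by simp
  have t: "(\<Sum>l<L. p' l * (1 - p' l)) \<ge> real L * (\<delta> / 4)"
  proof -
    have "\<delta> / 4 \<le> p' l * (1 - p' l)" if "l < L" for l
    proof -
      have "0 \<le> (p' l - \<delta> / 2) * (1 - \<delta> / 2 - p' l)"
        using p'[OF that] by (intro mult_nonneg_nonneg) auto
      moreover have "\<delta> * \<delta> \<le> \<delta> * 1" using \<delta> by (intro mult_left_mono) auto
      ultimately show ?thesis by (simp add: algebra_simps)
    qed
    hence "(\<Sum>l<L. \<delta> / 4) \<le> (\<Sum>l<L. p' l * (1 - p' l))" by (intro sum_mono) auto
    thus ?thesis by simp
  qed
  have "real L * (\<delta> / 4) \<le> real L * (\<delta> / 2)" using \<delta> by (intro mult_left_mono) auto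
  hence s: "(\<Sum>l<L. p l * (1 - p l)) \<ge> real L * (\<delta> / 4)"
    using variance_sum_ge[OF ij] unfolding variance_sum_def p_def by linarith
  have "\<bar>p l * (1 - p l) - p' l * (1 - p' l)\<bar> \<le> \<eta>" if "l < L" for l
  proof -
    have "p l * (1 - p l) - p' l * (1 - p' l) = (p l - p' l) * (1 - p l - p' l)"
      by (simp add: algebra_simps)
    also have "\<bar>\<dots>\<bar> = \<bar>p l - p' l\<bar> * \<bar>1 - p l - p' l\<bar>" by (rule abs_mult)
    also have "\<dots> \<le> \<eta> * 1"
    proof (rule mult_mono)
      show "\<bar>p l - p' l\<bar> \<le> \<eta>" using close[OF that] by (simp add: abs_minus_commute)
      show "\<bar>1 - p l - p' l\<bar> \<le> 1" using p[OF that] p'[OF that] \<delta> by linarith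
    qed (use \<eta> in auto)
    finally show ?thesis by simp
  qed
  hence "(\<Sum>l<L. \<bar>p l * (1 - p l) - p' l * (1 - p' l)\<bar>) \<le> (\<Sum>l<L. \<eta>)" by (intro sum_mono) auto
  hence st: "\<bar>(\<Sum>l<L. p l * (1 - p l)) - (\<Sum>l<L. p' l * (1 - p' l))\<bar> \<le> real L * \<eta>"
    using sum_abs[of "\<lambda>l. p l * (1 - p l) - p' l * (1 - p' l)" "{..<L}"] by (simp add: sum_subtractf)
  have "Rhat n L x gs gr i j = (a + d) / sqrt ((real n - 1) * (\<Sum>l<L. p' l * (1 - p' l)))"
    using False by (simp add: Rhat_def Omegahat_def a_def d_def p_def p'_def sum_subtractf)
  moreover have "ideal_entry L gs gr B x i j = a / sqrt (\<Sum>l<L. p l * (1 - p l))"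
    using False by (simp add: ideal_entry_def a_def p_def)
  ultimately show ?thesis
    using normalization_perturbation[OF _ _ _ _ a d s t st \<eta>(1), of "real n - 1"] L_pos n \<delta> by simp
qed

text \<open>The summand \<open>1 / card\<close> is a bias: diagonal pairs contribute 0 to the
  numerator but are counted in the denominator. The remaining deviation is Hoeffding's.\<close>

lemma Bhat_tail:
  assumes l: "l < L" and k: "k < Ks" and m: "m < Kr"
    and N: "card {i. i < n \<and> gs i = k} > 0" "card {j. j < n \<and> gr j = m} > 0" and t: "t \<ge> 0"
  shows "measure_pmf.prob (mlscbm n L gs gr B)
     {x. \<bar>Bhat n x gs gr l k m - B l k m\<bar> > t + 1 / real (card {i. i < n \<and> gs i = k})}
    \<le> 2 * exp (- 2 * t\<^sup>2 * (real (card {i. i < n \<and> gs i = k}) * real (card {j. j < n \<and> gr j = m})))"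
proof -
  define I where "I = {i. i < n \<and> gs i = k}"
  define J where "J = {j. j < n \<and> gr j = m}"
  have fin: "finite I" "finite J" by (auto simp: I_def J_def)
  define A where "A = (\<lambda>(i, j). (l, i, j)) ` {(i, j) \<in> I \<times> J. i \<noteq> j}"
  define M where "M = real (card I) * real (card J)"
  have M: "M > 0" using N by (simp add: M_def I_def J_def)
  have I0: "real (card I) > 0" and J0: "real (card J) > 0" using N by (simp_all add: I_def J_def)
  have inj: "inj_on (\<lambda>(i, j). (l, i, j)) {(i, j) \<in> I \<times> J. i \<noteq> j}" by (auto simp: inj_on_def)
  have A: "A \<subseteq> entries n L" using l by (auto simp: A_def entries_def I_def J_def)
  have "card A \<le> card (I \<times> J)"
    unfolding A_def card_image[OF inj] using fin by (intro card_mono) auto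
  hence cardA: "real (card A) \<le> M" unfolding M_def by (simp add: card_cartesian_product flip: of_nat_mult)
  define S where "S = (\<lambda>x. \<Sum>e\<in>A. (if x e then 1 else 0) - edge_prob e)"
  define P where "P = mlscbm n L gs gr B"
  have Bkm: "0 \<le> B l k m" "B l k m \<le> 1" using B_range[OF l k m] \<delta> by auto
  have det: "\<bar>Bhat n x gs gr l k m - B l k m\<bar> \<le> \<bar>S x\<bar> / M + 1 / real (card I)"
    if x: "\<And>i. \<not> x (l, i, i)" for x
  proof -
    have "(\<Sum>i\<in>I. \<Sum>j\<in>J. adj x l i j - B l k m) = (\<Sum>(i, j)\<in>I \<times> J. adj x l i j - B l k m)"
      by (rule sum.cartesian_product)
    also have "\<dots> = (\<Sum>(i, j)\<in>{(i, j) \<in> I \<times> J. i \<noteq> j}. adj x l i j - B l k m)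
        + (\<Sum>(i, j)\<in>{(i, j) \<in> I \<times> J. i = j}. adj x l i j - B l k m)"
    proof (subst sum.union_disjoint[symmetric])
      show "finite {(i, j) \<in> I \<times> J. i \<noteq> j}" "finite {(i, j) \<in> I \<times> J. i = j}"
        using fin by (auto intro: finite_subset[of _ "I \<times> J"])
    qed (auto intro!: sum.cong)
    also have "(\<Sum>(i, j)\<in>{(i, j) \<in> I \<times> J. i \<noteq> j}. adj x l i j - B l k m) = S x"
      unfolding S_def A_def sum.reindex[OF inj]
      by (intro sum.cong) (auto simp: adj_def edge_prob_def I_def J_def)
    also have "(\<Sum>(i, j)\<in>{(i, j) \<in> I \<times> J. i = j}. adj x l i j - B l k m) =
        - (real (card {(i, j) \<in> I \<times> J. i = j}) * B l k m)"
    proof -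
      have "(\<Sum>(i, j)\<in>{(i, j) \<in> I \<times> J. i = j}. adj x l i j - B l k m) =
          (\<Sum>(i, j)\<in>{(i, j) \<in> I \<times> J. i = j}. - B l k m)"
        using x by (intro sum.cong) (auto simp: adj_def)
      thus ?thesis by (simp add: case_prod_unfold)
    qed
    finally have eq: "(\<Sum>i\<in>I. \<Sum>j\<in>J. adj x l i j) - M * B l k m =
        S x - real (card {(i, j) \<in> I \<times> J. i = j}) * B l k m"
      by (simp add: sum_subtractf M_def mult.assoc)
    \<comment> \<open>Divided by the block size, this turns the diagonal deficit into
      \<open>1 / card I\<close>.\<close>
    have "card {(i, j) \<in> I \<times> J. i = j} \<le> card J"
      using fin by (intro card_inj_on_le[where f = snd]) (auto simp: inj_on_def)
    hence diag: "real (card {(i, j) \<in> I \<times> J. i = j}) * B l k m \<le> real (card J) * 1"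
      using Bkm by (intro mult_mono) auto
    have "\<bar>(\<Sum>i\<in>I. \<Sum>j\<in>J. adj x l i j) - M * B l k m\<bar> \<le> \<bar>S x\<bar> + real (card J)"
    proof -
      define z where "z = real (card {(i, j) \<in> I \<times> J. i = j}) * B l k m"
      have "z \<ge> 0" unfolding z_def using Bkm by (intro mult_nonneg_nonneg) auto
      moreover have "z \<le> real (card J)" using diag by (simp only: z_def mult_1_right)
      ultimately show ?thesis unfolding eq z_def[symmetric] by linarith
    qed
    hence "\<bar>(\<Sum>i\<in>I. \<Sum>j\<in>J. adj x l i j) - M * B l k m\<bar> / M \<le> (\<bar>S x\<bar> + real (card J)) / M"
      using M by (intro divide_right_mono) auto
    also have "\<dots> = \<bar>S x\<bar> / M + 1 / real (card I)" using I0 J0 by (simp add: add_divide_distrib M_def)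
    also have "\<bar>(\<Sum>i\<in>I. \<Sum>j\<in>J. adj x l i j) - M * B l k m\<bar> / M = \<bar>Bhat n x gs gr l k m - B l k m\<bar>"
    proof -
      have "Bhat n x gs gr l k m - B l k m = ((\<Sum>i\<in>I. \<Sum>j\<in>J. adj x l i j) - M * B l k m) / M"
        unfolding Bhat_def I_def[symmetric] J_def[symmetric] M_def[symmetric]
        using M by (simp add: diff_divide_distrib)
      thus ?thesis using M by simp
    qed
    finally show ?thesis .
  qed
  \<comment> \<open>Coordinates outside \<open>entries\<close> carry the default
    \<open>False\<close>, so diagonal values vanish almost surely.\<close>
  have supp: "\<not> x (l, i, i)" if "x \<in> set_pmf P" for x i
  proof -
    have "(l, i, i) \<notin> entries n L" by (simp add: entries_def)
    thus ?thesis
      using that set_Pi_pmf_subset[OF finite_entries, of False "\<lambda>e. bernoulli_pmf (edge_prob e)"]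
      unfolding P_def mlscbm_alt by blast
  qed
  have "measure_pmf.prob P {x. \<bar>Bhat n x gs gr l k m - B l k m\<bar> > t + 1 / real (card I)}
      \<le> measure_pmf.prob P {x. \<bar>S x\<bar> \<ge> t * M}"
  proof (rule measure_pmf.finite_measure_mono_AE)
    show "AE x in measure_pmf P. x \<in> {x. \<bar>Bhat n x gs gr l k m - B l k m\<bar> > t + 1 / real (card I)} \<longrightarrow>
        x \<in> {x. \<bar>S x\<bar> \<ge> t * M}"
    proof (rule AE_pmfI, intro impI)
      fix x assume x: "x \<in> set_pmf P" "x \<in> {x. \<bar>Bhat n x gs gr l k m - B l k m\<bar> > t + 1 / real (card I)}"
      hence "t < \<bar>S x\<bar> / M" using det[of x] supp[of x] by force
      thus "x \<in> {x. \<bar>S x\<bar> \<ge> t * M}" using M by (simp add: field_simps)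
    qed
  qed simp
  also have "\<dots> = measure_pmf.prob (Pi_pmf A False (\<lambda>e. bernoulli_pmf (edge_prob e))) {x. \<bar>S x\<bar> \<ge> t * M}"
  proof -
    have "S (\<lambda>e. if e \<in> A then x e else False) = S x" for x
      unfolding S_def by (intro sum.cong) auto
    thus ?thesis unfolding P_def mlscbm_alt Pi_pmf_subset[OF finite_entries A] by simp
  qed
  also have "\<dots> \<le> 2 * exp (- 2 * (t * M)\<^sup>2 / M)"
    unfolding S_def
  proof (rule bernoulli_sum_tail)
    show "0 \<le> edge_prob e \<and> edge_prob e \<le> 1" if "e \<in> A" for e
      using edge_prob_entries[of e] that A \<delta> by force
  qed (use A finite_entries cardA M t in \<open>auto intro: finite_subset\<close>)
  also have "- 2 * (t * M)\<^sup>2 / M = - 2 * t\<^sup>2 * M" using M by (simp add: power2_eq_square)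
  finally show ?thesis by (simp add: P_def I_def J_def M_def)
qed

end

section \<open>Asymptotics\<close>

text \<open>Final barrier and total risk with the locale constants unfolded, so that limits in
  \<open>n\<close> can be taken.\<close>

definition edge_bound :: "nat \<Rightarrow> real \<Rightarrow> real \<Rightarrow> real \<Rightarrow> real" where
  "edge_bound n \<eta> K s =
     2 + real n * (1 / ((real n - 1) * (1/2 - 3 * \<eta>))) + (real n / K + 1) * (s / real n)"

definition failure_bound :: "nat \<Rightarrow> real \<Rightarrow> real \<Rightarrow> real \<Rightarrow> real \<Rightarrow> real" where
  "failure_bound n c \<eta> K s = 16 * (160 * c^3)^3 *
     (1 / ((real n - 1)^4 * \<eta>^4) + 1 / ((real n - 1)\<^sup>2 * (1/2 - 3 * \<eta>)\<^sup>2 * (\<eta> * real n)\<^sup>2)) *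
     (real n * (real n * K)\<^sup>2 + (real n / K + 1) * ((real n)\<^sup>2 / s)\<^sup>2)"

lemma (in barrier) norm_bound_explicit:
  "measure_pmf.prob (Pi_pmf {..<n} (\<lambda>_. 0) row)
     {x. \<exists>w. (\<Sum>i<n. (\<Sum>j<n. x i j * w j)\<^sup>2 / N) > edge_bound n \<eta> K s * (\<Sum>j<n. (w j)\<^sup>2)}
   \<le> failure_bound n c \<eta> K s"
proof -
  have \<theta>': "1 - \<theta> = 1/2 - 3 * \<eta>" by (simp add: \<theta>_def)
  have "edge_bound n \<eta> K s = 2 + real n * \<delta>0 + Bmax * (s / real n)"
    unfolding edge_bound_def \<delta>0_def Bmax_def \<theta>' N_def ..
  moreover have "failure_bound n c \<eta> K s =
      \<kappa> * (real n * (real n * K)\<^sup>2 + Bmax * ((real n)\<^sup>2 / s)\<^sup>2)"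
    unfolding failure_bound_def \<kappa>_def C_def Bmax_def \<theta>' N_def ..
  hence "failure_bound n c \<eta> K s = real n * g1 + Bmax * g2"
    by (simp add: g1_def g2_def distrib_left mult.left_commute)
  ultimately show ?thesis using norm_bound_probability by simp
qed

context sbm
begin

lemma ideal_norm_bound:
  assumes "n \<ge> 2" "0 < \<eta>" "\<eta> \<le> 1/12" "0 < K" "0 < s"
    "(1/2 + \<eta>) * (real n / (real n - 1)) + \<eta> \<le> 1/2 + 3 * \<eta>"
    "1 / ((real n - 1) * (1/2 - 3 * \<eta>)) \<le> s / real n"
  shows "measure_pmf.prob (mlscbm n L gs gr B)
     {x. \<exists>w. (\<Sum>i<n. (\<Sum>j<n. ideal_entry L gs gr B x i j / sqrt (real n - 1) * w j)\<^sup>2)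
        > edge_bound n \<eta> K s * (\<Sum>j<n. (w j)\<^sup>2)}
    \<le> failure_bound n (1 + 2 * 8^8 * exp (1 / (4 * \<delta>))) \<eta> K s"
proof -
  interpret barrier n entry_pmf "1 + 2 * 8^8 * exp (1 / (4 * \<delta>))" \<eta> K s
    using assms entry_moments by unfold_locales auto
  have sq: "(\<Sum>i<n. (\<Sum>j<n. ideal_entry L gs gr B x i j / sqrt (real n - 1) * w j)\<^sup>2) =
      (\<Sum>i<n. (\<Sum>j<n. ideal_entry L gs gr B x i j * w j)\<^sup>2 / N)" for x w
  proof (intro sum.cong refl)
    fix i
    have "(\<Sum>j<n. ideal_entry L gs gr B x i j / sqrt (real n - 1) * w j) =
        (\<Sum>j<n. ideal_entry L gs gr B x i j * w j) / sqrt (real n - 1)"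
      by (simp add: sum_divide_distrib)
    thus "(\<Sum>j<n. ideal_entry L gs gr B x i j / sqrt (real n - 1) * w j)\<^sup>2 =
        (\<Sum>j<n. ideal_entry L gs gr B x i j * w j)\<^sup>2 / N"
      using assms(1) by (simp add: power_divide N_def)
  qed
  have clip: "(\<Sum>i<n. (\<Sum>j<n. (if i \<in> {..<n} then \<lambda>j. if j \<in> {..<n} then ideal_entry L gs gr B x i j else 0
        else (\<lambda>_. 0)) j * w j)\<^sup>2 / N) = (\<Sum>i<n. (\<Sum>j<n. ideal_entry L gs gr B x i j * w j)\<^sup>2 / N)" for x w
    by (intro sum.cong refl) simp
  have row: "Pi_pmf {..<n} (\<lambda>_. 0) row = Pi_pmf {..<n} (\<lambda>_. 0) (\<lambda>i. Pi_pmf {..<n} 0 (entry_pmf i))"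
    by (simp add: row_def[abs_def])
  show ?thesis
    using norm_bound_explicit
    unfolding row matrix_distribution[symmetric] sq measure_map_pmf vimage_def mem_Collect_eq clip .
qed

lemma Bhat_uniform:
  fixes c0 :: real
  assumes n: "n \<ge> 3" and c0: "c0 > 0"
    and bal: "\<And>k. k < Ks \<Longrightarrow> real (card {i. i < n \<and> gs i = k}) \<ge> c0 * real n / real Ks"
      "\<And>m. m < Kr \<Longrightarrow> real (card {j. j < n \<and> gr j = m}) \<ge> c0 * real n / real Kr"
  defines "K \<equiv> real (max Ks Kr)"
  shows "measure_pmf.prob (mlscbm n L gs gr B)
     {x. \<exists>l<L. \<exists>k<Ks. \<exists>m<Kr. \<bar>Bhat n x gs gr l k m - B l k m\<bar> > 2 * (K * sqrt (ln (real n)) / (c0 * real n))}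
    \<le> 2 * (K\<^sup>2 * real L * ln (real n) / real n)"
proof -
  \<comment> \<open>Chosen so that \<open>t * z = sqrt (ln n)\<close> for the lower bound
    \<open>z\<close> of both community sizes, which gives tails \<open>2 / n^2\<close>. In the
    threshold \<open>2 * t\<close>, one \<open>t\<close> is for the deviation and one for the
    diagonal bias.\<close>
  define t where "t = K * sqrt (ln (real n)) / (c0 * real n)"
  define P where "P = mlscbm n L gs gr B"
  define E where "E = (\<lambda>(l, k, m). {x. \<bar>Bhat n x gs gr l k m - B l k m\<bar> > 2 * t})"
  have n0: "real n > 0" using n by simp
  have "exp 1 \<le> real n" using exp_le n by linarith
  hence ln1: "1 \<le> ln (real n)" using n0 by (simp add: ln_ge_iff)
  hence sq1: "1 \<le> sqrt (ln (real n))" by simp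
  have "gs 0 < Ks" using gs_range[of 0] n by simp
  hence K: "K \<ge> 1" by (auto simp: K_def)
  have t: "t \<ge> 0" using K c0 ln1 by (simp add: t_def)
  have single: "measure_pmf.prob P (E (l, k, m)) \<le> 2 / (real n)\<^sup>2" if lkm: "l < L" "k < Ks" "m < Kr" for l k m
  proof -
    define a where "a = real (card {i. i < n \<and> gs i = k})"
    define b where "b = real (card {j. j < n \<and> gr j = m})"
    define z where "z = c0 * real n / K"
    have z: "z > 0" using c0 n0 K by (simp add: z_def)
    have "z \<le> c0 * real n / real Ks" unfolding z_def K_def
      using c0 lkm by (intro divide_left_mono) auto
    hence a: "z \<le> a" using bal(1)[OF lkm(2)] by (simp add: a_def)
    have "z \<le> c0 * real n / real Kr" unfolding z_def K_def
      using c0 lkm by (intro divide_left_mono) auto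
    hence b: "z \<le> b" using bal(2)[OF lkm(3)] by (simp add: b_def)
    have "1 / a \<le> 1 / z" using a z by (intro divide_left_mono) auto
    also have "\<dots> = K / (c0 * real n) * 1" by (simp add: z_def)
    also have "\<dots> \<le> K / (c0 * real n) * sqrt (ln (real n))"
      using sq1 K c0 by (intro mult_left_mono) auto
    finally have at: "1 / a \<le> t" by (simp add: t_def)
    have tz: "t\<^sup>2 * (z * z) = ln (real n)"
    proof -
      have "t * z = sqrt (ln (real n))" using K c0 n0 by (simp add: t_def z_def)
      hence "(t * z)\<^sup>2 = ln (real n)" using ln1 by simp
      thus ?thesis by (simp add: power2_eq_square mult_ac)
    qed
    have "measure_pmf.prob P (E (l, k, m)) \<le> measure_pmf.prob P {x. \<bar>Bhat n x gs gr l k m - B l k m\<bar> > t + 1 / a}"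
      using at by (intro measure_pmf.finite_measure_mono) (auto simp: E_def)
    also have "\<dots> \<le> 2 * exp (- 2 * t\<^sup>2 * (a * b))"
      unfolding P_def a_def b_def using a b z t lkm
      by (intro Bhat_tail) (auto simp: a_def b_def intro: Nat.gr0I)
    also have "\<dots> \<le> 2 * exp (- 2 * ln (real n))"
    proof -
      have "t\<^sup>2 * (z * z) \<le> t\<^sup>2 * (a * b)" using a b z by (intro mult_left_mono mult_mono) auto
      thus ?thesis using tz by simp
    qed
    also have "exp (- 2 * ln (real n)) = 1 / (real n)\<^sup>2"
    proof -
      have "exp (2 * ln (real n)) = (real n)\<^sup>2"
        using n0 exp_of_nat_mult[of 2 "ln (real n)"] by simp
      thus ?thesis by (simp add: exp_minus inverse_eq_divide)
    qed
    finally show ?thesis by simp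
  qed
  define I where "I = {..<L} \<times> {..<Ks} \<times> {..<Kr}"
  have "measure_pmf.prob P (\<Union>e\<in>I. E e) \<le> (\<Sum>e\<in>I. measure_pmf.prob P (E e))"
    by (intro measure_pmf.finite_measure_subadditive_finite) (auto simp: I_def)
  also have "\<dots> \<le> (\<Sum>e\<in>I. 2 / (real n)\<^sup>2)" using single by (intro sum_mono) (auto simp: I_def)
  also have "\<dots> = real L * (real Ks * real Kr) * (2 / (real n)\<^sup>2)"
    by (simp add: I_def card_cartesian_product)
  also have "\<dots> \<le> real L * (K * K) * (2 / (real n)\<^sup>2)"
    unfolding K_def by (intro mult_right_mono mult_left_mono mult_mono) auto
  also have "\<dots> = 2 * (K\<^sup>2 * real L / real n) * (1 / real n)" by (simp add: power2_eq_square)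
  \<comment> \<open>A deliberate weakening, to express the failure probability by the quantity in
    Assumption 3.\<close>
  also have "\<dots> \<le> 2 * (K\<^sup>2 * real L / real n) * ln (real n)"
  proof (rule mult_left_mono)
    have "1 / real n \<le> 1" using n by simp
    thus "1 / real n \<le> ln (real n)" using ln1 by linarith
  qed simp
  finally have "measure_pmf.prob P (\<Union>e\<in>I. E e) \<le> 2 * (K\<^sup>2 * real L * ln (real n) / real n)" by simp
  moreover have "(\<Union>e\<in>I. E e) = {x. \<exists>l<L. \<exists>k<Ks. \<exists>m<Kr. \<bar>Bhat n x gs gr l k m - B l k m\<bar> > 2 * t}"
    by (auto simp: I_def E_def)
  ultimately show ?thesis by (simp add: P_def t_def)
qed

text \<open>Union bound over four failures: the two label recoveries, the block means and the ideal
  norm. All estimation error is expressed by the quantity \<open>a\<close> of Assumption 3: failure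
  probability \<open>2 * a\<close>, mean error via \<open>sqrt a / c0\<close>, effect on the norm
  via \<open>sqrt (2 * a)\<close>.\<close>

lemma sigma1_probability:
  fixes c0 \<epsilon> :: real and G :: "network \<Rightarrow> (nat \<Rightarrow> nat) \<times> (nat \<Rightarrow> nat)"
  assumes n: "n \<ge> 3" and c0: "c0 > 0"
    and bal: "\<And>k. k < Ks \<Longrightarrow> real (card {i. i < n \<and> gs i = k}) \<ge> c0 * real n / real Ks"
      "\<And>m. m < Kr \<Longrightarrow> real (card {j. j < n \<and> gr j = m}) \<ge> c0 * real n / real Kr"
    and \<eta>: "0 < \<eta>" "\<eta> \<le> 1/12" and "0 < K" "0 < s"
      "(1/2 + \<eta>) * (real n / (real n - 1)) + \<eta> \<le> 1/2 + 3 * \<eta>"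
      "1 / ((real n - 1) * (1/2 - 3 * \<eta>)) \<le> s / real n"
    and T: "edge_bound n \<eta> K s \<le> (2 + \<epsilon> / 4)\<^sup>2" and \<epsilon>: "\<epsilon> > 0"
  defines "a \<equiv> (real (max Ks Kr))\<^sup>2 * real L * ln (real n) / real n"
  assumes a1: "sqrt a / c0 \<le> \<delta> / 4" and a2: "12 / (c0 * \<delta>\<^sup>2) * sqrt (2 * a) \<le> \<epsilon> / 4"
  shows "measure_pmf.prob (mlscbm n L gs gr B)
      {x. sigma1 n (Rhat n L x (fst (G x)) (snd (G x))) - 2 < \<epsilon>}
    \<ge> measure_pmf.prob (mlscbm n L gs gr B) {x. labels_equiv n Ks (fst (G x)) gs}
      + measure_pmf.prob (mlscbm n L gs gr B) {x. labels_equiv n Kr (snd (G x)) gr} - 1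
      - 2 * a - failure_bound n (1 + 2 * 8^8 * exp (1 / (4 * \<delta>))) \<eta> K s"
proof -
  define P where "P = mlscbm n L gs gr B"
  define k where "k = real (max Ks Kr)"
  define t where "t = k * sqrt (ln (real n)) / (c0 * real n)"
  define T where "T = edge_bound n \<eta> K s"
  define X where "X = (\<lambda>x i j. ideal_entry L gs gr B x i j / sqrt (real n - 1))"
  define E1 where "E1 = {x. labels_equiv n Ks (fst (G x)) gs}"
  define E2 where "E2 = {x. labels_equiv n Kr (snd (G x)) gr}"
  define F3 where "F3 = {x. \<exists>l<L. \<exists>k<Ks. \<exists>m<Kr. \<bar>Bhat n x gs gr l k m - B l k m\<bar> > 2 * t}"
  define F4 where "F4 = {x. \<exists>w. (\<Sum>i<n. (\<Sum>j<n. X x i j * w j)\<^sup>2) > T * (\<Sum>j<n. (w j)\<^sup>2)}"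
  define E where "E = {x. sigma1 n (Rhat n L x (fst (G x)) (snd (G x))) - 2 < \<epsilon>}"
  have n0: "real n > 0" and n1: "real n - 1 > 0" using n by simp_all
  have lnn: "ln (real n) \<ge> 0" using n by simp
  have k0: "k \<ge> 0" by (simp add: k_def)
  have L1: "real L \<ge> 1" using L_pos by simp
  have a: "a = k\<^sup>2 * real L * ln (real n) / real n" by (simp add: a_def k_def)
  have t0: "t \<ge> 0" using k0 lnn c0 by (simp add: t_def)
  have "t \<le> sqrt a / c0"
  proof -
    have "k\<^sup>2 * ln (real n) / (real n)\<^sup>2 \<le> a"
    proof -
      have "k\<^sup>2 * ln (real n) / (real n)\<^sup>2 = (k\<^sup>2 * ln (real n) / real n) * (1 / real n)"
        by (simp add: power2_eq_square)
      also have "\<dots> \<le> (k\<^sup>2 * ln (real n) / real n) * real L"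
      proof (rule mult_left_mono)
        have "1 / real n \<le> 1" using n by simp
        thus "1 / real n \<le> real L" using L1 by linarith
      qed (use lnn in simp)
      also have "\<dots> = a" by (simp add: a)
      finally show ?thesis .
    qed
    hence "sqrt (k\<^sup>2 * ln (real n) / (real n)\<^sup>2) \<le> sqrt a" by (rule real_sqrt_le_mono)
    also have "sqrt (k\<^sup>2 * ln (real n) / (real n)\<^sup>2) = k * sqrt (ln (real n)) / real n"
      using k0 n0 by (simp add: real_sqrt_mult real_sqrt_divide)
    finally have "k * sqrt (ln (real n)) / real n / c0 \<le> sqrt a / c0"
      using c0 by (intro divide_right_mono) auto
    thus ?thesis by (simp add: t_def mult.commute)
  qed
  hence t\<delta>: "2 * t \<le> \<delta> / 2" using a1 by linarith
  define e where "e = sqrt (real L / (real n - 1)) * (2 * t) * (6 / \<delta>\<^sup>2)"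
  have ne: "real n * e \<le> \<epsilon> / 4"
  proof -
    have "real n * e = 12 / (c0 * \<delta>\<^sup>2) * (k * sqrt (ln (real n)) * sqrt (real L / (real n - 1)))"
      using n0 c0 by (simp add: e_def t_def)
    also have "k * sqrt (ln (real n)) * sqrt (real L / (real n - 1)) =
        sqrt (k\<^sup>2 * ln (real n) * (real L / (real n - 1)))"
      using k0 by (simp add: real_sqrt_mult real_sqrt_divide)
    \<comment> \<open>The factor 2 pays for replacing \<open>n - 1\<close> by
      \<open>n\<close>.\<close>
    also have "\<dots> \<le> sqrt (2 * a)"
    proof (rule real_sqrt_le_mono)
      have "1 / (real n - 1) \<le> 2 / real n" using n by (simp add: field_simps)
      hence "k\<^sup>2 * ln (real n) * real L * (1 / (real n - 1)) \<le> k\<^sup>2 * ln (real n) * real L * (2 / real n)"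
        using lnn by (intro mult_left_mono) auto
      thus "k\<^sup>2 * ln (real n) * (real L / (real n - 1)) \<le> 2 * a" by (simp add: a mult_ac)
    qed
    finally show ?thesis using a2 c0 by (smt (verit) mult_left_mono divide_nonneg_nonneg mult_nonneg_nonneg zero_le_power2)
  qed
  have T0: "T \<ge> 0"
    unfolding T_def edge_bound_def using n1 \<eta> \<open>0 < K\<close> \<open>0 < s\<close>
    by (intro add_nonneg_nonneg mult_nonneg_nonneg divide_nonneg_nonneg) auto
  have "E1 \<inter> E2 - F3 - F4 \<subseteq> E"
  proof
    fix x assume x: "x \<in> E1 \<inter> E2 - F3 - F4"
    have R: "Rhat n L x (fst (G x)) (snd (G x)) i j = Rhat n L x gs gr i j" if "i < n" "j < n" for i j
      using x that gs_range gr_range by (intro Rhat_labels_equiv) (auto simp: E1_def E2_def)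
    have "sigma1 n (Rhat n L x (fst (G x)) (snd (G x))) \<le> sqrt T + real n * e"
    proof (rule sigma1_perturbation[where X = "X x"])
      fix i j assume ij: "i < n" "j < n"
      have "\<bar>Bhat n x gs gr l (gs i) (gr j) - B l (gs i) (gr j)\<bar> \<le> 2 * t" if "l < L" for l
        using x that gs_range[OF ij(1)] gr_range[OF ij(2)] by (force simp: F3_def)
      hence "\<bar>Rhat n L x gs gr i j - X x i j\<bar> \<le> e"
        unfolding X_def e_def using n t0 t\<delta> ij by (intro Rhat_near_ideal) auto
      thus "\<bar>Rhat n L x (fst (G x)) (snd (G x)) i j - X x i j\<bar> \<le> e" by (simp add: R[OF ij])
    next
      show "(\<Sum>i<n. (\<Sum>j<n. X x i j * w j)\<^sup>2) \<le> T * (\<Sum>j<n. (w j)\<^sup>2)" for w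
        using x by (auto simp: F4_def not_less)
    qed (use n T0 in auto)
    also have "sqrt T \<le> 2 + \<epsilon> / 4"
      using T \<epsilon> unfolding T_def by (intro real_le_lsqrt) auto
    finally show "x \<in> E" using ne \<epsilon> by (simp add: E_def)
  qed
  hence "- E \<subseteq> ((- E1 \<union> - E2) \<union> F3) \<union> F4" by auto
  hence "measure_pmf.prob P (- E) \<le> measure_pmf.prob P (((- E1 \<union> - E2) \<union> F3) \<union> F4)"
    by (intro measure_pmf.finite_measure_mono) auto
  also have "\<dots> \<le> measure_pmf.prob P (- E1) + measure_pmf.prob P (- E2)
      + measure_pmf.prob P F3 + measure_pmf.prob P F4"
    by (intro order_trans[OF measure_Un_le] add_mono order_refl) auto
  also have "measure_pmf.prob P F3 \<le> 2 * a"
    unfolding P_def F3_def t_def a k_def using n c0 bal by (intro Bhat_uniform) auto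
  also have "measure_pmf.prob P F4 \<le> failure_bound n (1 + 2 * 8^8 * exp (1 / (4 * \<delta>))) \<eta> K s"
    unfolding P_def F4_def T_def X_def using n assms by (intro ideal_norm_bound) auto
  finally have "measure_pmf.prob P (- E) \<le> measure_pmf.prob P (- E1) + measure_pmf.prob P (- E2)
      + 2 * a + failure_bound n (1 + 2 * 8^8 * exp (1 / (4 * \<delta>))) \<eta> K s" by simp
  moreover have "measure_pmf.prob P (- S) = 1 - measure_pmf.prob P S" for S
    using measure_pmf.prob_compl[of S P] by (simp add: Compl_eq_Diff_UNIV)
  ultimately show ?thesis unfolding P_def E_def E1_def E2_def by simp
qed

end

text \<open>With a prefactor of order \<open>n^-4\<close>, the two contributions are of order
  \<open>K^2 / n\<close> and \<open>n / (K * s^2)\<close>, while the extra shifts move the barrier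
  by about \<open>s / K\<close>. All three vanish when \<open>s\<close> is below \<open>K\<close>,
  \<open>K\<close> below \<open>sqrt n\<close> and \<open>K * s^2\<close> above \<open>n\<close> by
  powers of \<open>n\<close>; exponents 9/20 and 2/5 do this.\<close>

lemma failure_bound_tendsto:
  "(\<lambda>n. failure_bound n c \<eta> (real n powr (9/20)) (real n powr (2/5))) \<longlonglongrightarrow> 0"
proof -
  define u where "u = (\<lambda>n. real n * (real n * real n powr (9/20))\<^sup>2 +
      (real n / real n powr (9/20) + 1) * ((real n)\<^sup>2 / real n powr (2/5))\<^sup>2)"
  have 1: "(\<lambda>n. u n / (real n - 1)^4) \<longlonglongrightarrow> 0" unfolding u_def by real_asymp
  have 2: "(\<lambda>n. u n / ((real n - 1)\<^sup>2 * (real n)\<^sup>2)) \<longlonglongrightarrow> 0" unfolding u_def by real_asymp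
  have "(\<lambda>n. 16 * (160 * c^3)^3 * (1 / \<eta>^4 * (u n / (real n - 1)^4)
      + 1 / ((1/2 - 3 * \<eta>)\<^sup>2 * \<eta>\<^sup>2) * (u n / ((real n - 1)\<^sup>2 * (real n)\<^sup>2))))
    \<longlonglongrightarrow> 16 * (160 * c^3)^3 * (1 / \<eta>^4 * 0 + 1 / ((1/2 - 3 * \<eta>)\<^sup>2 * \<eta>\<^sup>2) * 0)"
    by (intro tendsto_intros 1 2)
  moreover have "failure_bound n c \<eta> (real n powr (9/20)) (real n powr (2/5)) =
    16 * (160 * c^3)^3 * (1 / \<eta>^4 * (u n / (real n - 1)^4)
      + 1 / ((1/2 - 3 * \<eta>)\<^sup>2 * \<eta>\<^sup>2) * (u n / ((real n - 1)\<^sup>2 * (real n)\<^sup>2)))" for n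
  proof -
    have "failure_bound n c \<eta> (real n powr (9/20)) (real n powr (2/5)) = 16 * (160 * c^3)^3 *
      (1 / ((real n - 1)^4 * \<eta>^4) + 1 / ((real n - 1)\<^sup>2 * (1/2 - 3 * \<eta>)\<^sup>2 * (\<eta> * real n)\<^sup>2)) * u n"
      unfolding failure_bound_def u_def ..
    thus ?thesis by (simp add: power_mult_distrib distrib_left distrib_right mult_ac)
  qed
  ultimately show ?thesis by simp
qed

lemma edge_bound_tendsto:
  "(\<lambda>n. edge_bound n \<eta> (real n powr (9/20)) (real n powr (2/5))) \<longlonglongrightarrow> 2 + 1 / (1/2 - 3 * \<eta>)"
proof -
  have 1: "(\<lambda>n. real n / (real n - 1)) \<longlonglongrightarrow> 1" by real_asymp
  have 2: "(\<lambda>n. (real n / real n powr (9/20) + 1) * (real n powr (2/5) / real n)) \<longlonglongrightarrow> 0" by real_asymp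
  have "(\<lambda>n. 2 + real n / (real n - 1) * (1 / (1/2 - 3 * \<eta>)) +
      (real n / real n powr (9/20) + 1) * (real n powr (2/5) / real n)) \<longlonglongrightarrow> 2 + 1 * (1 / (1/2 - 3 * \<eta>)) + 0"
    by (intro tendsto_intros 1 2)
  thus ?thesis by (simp add: edge_bound_def)
qed

theorem theorem1:
  fixes Ks Kr Ks0 Kr0 L :: "nat \<Rightarrow> nat"
    and gs gr :: "nat \<Rightarrow> nat \<Rightarrow> nat"
    and B :: "nat \<Rightarrow> nat \<Rightarrow> nat \<Rightarrow> nat \<Rightarrow> real"
    and M :: "nat \<Rightarrow> nat \<Rightarrow> nat \<Rightarrow> nat \<Rightarrow> network \<Rightarrow> (nat \<Rightarrow> nat) \<times> (nat \<Rightarrow> nat)"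
    and \<delta> c0 \<epsilon> :: real
  assumes L_pos: "\<And>n. L n \<ge> 1"
    and gs_range: "\<And>n i. i < n \<Longrightarrow> gs n i < Ks n"
    and gr_range: "\<And>n j. j < n \<Longrightarrow> gr n j < Kr n"
    and H0: "\<And>n. Ks0 n = Ks n \<and> Kr0 n = Kr n"
    and A1: "0 < \<delta>" "\<delta> < 1/2"
      "\<And>n l k m. l < L n \<Longrightarrow> k < Ks n \<Longrightarrow> m < Kr n \<Longrightarrow>
          \<delta> \<le> B n l k m \<and> B n l k m \<le> 1 - \<delta>"
    and A2: "c0 > 0"
      "\<And>n k. k < Ks n \<Longrightarrow> real (card {i. i < n \<and> gs n i = k}) \<ge> c0 * real n / real (Ks n)"
      "\<And>n m. m < Kr n \<Longrightarrow> real (card {j. j < n \<and> gr n j = m}) \<ge> c0 * real n / real (Kr n)"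
    and A3: "(\<lambda>n. (real (max (Ks n) (Kr n)))\<^sup>2 * real (L n) * ln (real n) / real n) \<longlonglongrightarrow> 0"
    and A4s: "(\<lambda>n. measure_pmf.prob (mlscbm n (L n) (gs n) (gr n) (B n))
                {x. labels_equiv n (Ks n) (fst (M n (L n) (Ks n) (Kr n) x)) (gs n)}) \<longlonglongrightarrow> 1"
    and A4r: "(\<lambda>n. measure_pmf.prob (mlscbm n (L n) (gs n) (gr n) (B n))
                {x. labels_equiv n (Kr n) (snd (M n (L n) (Ks n) (Kr n) x)) (gr n)}) \<longlonglongrightarrow> 1"
    and eps: "\<epsilon> > 0"
  shows "(\<lambda>n. measure_pmf.prob (mlscbm n (L n) (gs n) (gr n) (B n))
            {x. let g = M n (L n) (Ks0 n) (Kr0 n) x in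
                sigma1 n (Rhat n (L n) x (fst g) (snd g)) - 2 < \<epsilon>}) \<longlonglongrightarrow> 1"
proof -
  \<comment> \<open>\<open>\<eta> \<le> 1/24\<close> gives
    \<open>1 / (1/2 - 3 * \<eta>) \<le> 2 + 24 * \<eta>\<close>, and \<open>\<epsilon> / 96\<close>
    makes \<open>24 * \<eta>\<close> at most \<open>\<epsilon> / 4\<close>, below the gap between 4
    and \<open>(2 + \<epsilon> / 4)^2\<close>.\<close>
  define \<eta> where "\<eta> = min (1/24) (\<epsilon> / 96)"
  have \<eta>: "0 < \<eta>" "\<eta> \<le> 1/24" "\<eta> \<le> \<epsilon> / 96" using eps by (auto simp: \<eta>_def)
  define K where "K = (\<lambda>n. real n powr (9/20))"
  define s where "s = (\<lambda>n. real n powr (2/5))"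
  define a where "a = (\<lambda>n. (real (max (Ks n) (Kr n)))\<^sup>2 * real (L n) * ln (real n) / real n)"
  define F where "F = (\<lambda>n. failure_bound n (1 + 2 * 8^8 * exp (1 / (4 * \<delta>))) \<eta> (K n) (s n))"
  define ps where "ps = (\<lambda>n. measure_pmf.prob (mlscbm n (L n) (gs n) (gr n) (B n))
                {x. labels_equiv n (Ks n) (fst (M n (L n) (Ks n) (Kr n) x)) (gs n)})"
  define pr where "pr = (\<lambda>n. measure_pmf.prob (mlscbm n (L n) (gs n) (gr n) (B n))
                {x. labels_equiv n (Kr n) (snd (M n (L n) (Ks n) (Kr n) x)) (gr n)})"
  have a: "a \<longlonglongrightarrow> 0" using A3 by (simp add: a_def)
  have F: "F \<longlonglongrightarrow> 0" unfolding F_def K_def s_def by (rule failure_bound_tendsto)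
  have T: "(\<lambda>n. edge_bound n \<eta> (K n) (s n)) \<longlonglongrightarrow> 2 + 1 / (1/2 - 3 * \<eta>)"
    unfolding K_def s_def by (rule edge_bound_tendsto)
  have "1 / (1/2 - 3 * \<eta>) \<le> 2 + 24 * \<eta>"
  proof -
    have "\<eta> * 72 * \<eta> \<le> \<eta> * 6" using \<eta> by (intro order_trans[OF _ mult_left_mono[of "72 * \<eta>" 6]]) auto
    thus ?thesis using \<eta> by (simp add: field_simps)
  qed
  also have "24 * \<eta> < \<epsilon> + (\<epsilon> / 4)\<^sup>2" using \<eta> eps zero_le_power2[of "\<epsilon> / 4"] by linarith
  finally have "2 + 1 / (1/2 - 3 * \<eta>) < (2 + \<epsilon> / 4)\<^sup>2" by (simp add: power2_sum)
  with T have ev1: "eventually (\<lambda>n. edge_bound n \<eta> (K n) (s n) < (2 + \<epsilon> / 4)\<^sup>2) sequentially"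
    by (rule order_tendstoD)
  have "(\<lambda>n. real n / (real n - 1)) \<longlonglongrightarrow> 1" by real_asymp
  hence "(\<lambda>n. (1/2 + \<eta>) * (real n / (real n - 1)) + \<eta>) \<longlonglongrightarrow> (1/2 + \<eta>) * 1 + \<eta>"
    by (intro tendsto_intros)
  hence ev2: "eventually (\<lambda>n. (1/2 + \<eta>) * (real n / (real n - 1)) + \<eta> < 1/2 + 3 * \<eta>) sequentially"
    by (rule order_tendstoD) (use \<eta> in simp)
  \<comment> \<open>\<open>1/4\<close> stands in for \<open>1/2 - 3 * \<eta>\<close>, which is at
    least \<open>3/8\<close>; thus the limit is free of \<open>\<eta>\<close>, and
    \<open>s n\<close> tending to infinity settles it.\<close>
  have ev3: "eventually (\<lambda>n. 1 / ((real n - 1) * (1/4)) \<le> s n / real n) sequentially"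
    unfolding s_def by real_asymp
  have "(\<lambda>n. sqrt (a n) / c0) \<longlonglongrightarrow> sqrt 0 / c0" using A2(1) by (intro tendsto_intros a) auto
  hence ev4: "eventually (\<lambda>n. sqrt (a n) / c0 < \<delta> / 4) sequentially"
    by (rule order_tendstoD) (use A1 in simp)
  have "(\<lambda>n. 12 / (c0 * \<delta>\<^sup>2) * sqrt (2 * a n)) \<longlonglongrightarrow> 12 / (c0 * \<delta>\<^sup>2) * sqrt (2 * 0)"
    by (intro tendsto_intros a)
  hence ev5: "eventually (\<lambda>n. 12 / (c0 * \<delta>\<^sup>2) * sqrt (2 * a n) < \<epsilon> / 4) sequentially"
    by (rule order_tendstoD) (use eps in simp)
  show ?thesis
  proof (rule tendsto_sandwich)
    have "(\<lambda>n. ps n + pr n - 1 - 2 * a n - F n) \<longlonglongrightarrow> 1 + 1 - 1 - 2 * 0 - 0"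
      using A4s A4r unfolding ps_def[symmetric] pr_def[symmetric] by (intro tendsto_intros a F)
    thus "(\<lambda>n. ps n + pr n - 1 - 2 * a n - F n) \<longlonglongrightarrow> 1" by simp
    show "\<forall>\<^sub>F n in sequentially. ps n + pr n - 1 - 2 * a n - F n \<le>
      measure_pmf.prob (mlscbm n (L n) (gs n) (gr n) (B n))
            {x. let g = M n (L n) (Ks0 n) (Kr0 n) x in
                sigma1 n (Rhat n (L n) x (fst g) (snd g)) - 2 < \<epsilon>}"
      using ev1 ev2 ev3 ev4 ev5 eventually_ge_at_top[of 3]
    proof eventually_elim
      case (elim n)
      interpret sbm n "L n" "Ks n" "Kr n" "gs n" "gr n" "B n" \<delta>
        using L_pos gs_range gr_range A1 by unfold_locales auto
      have "1 / ((real n - 1) * (1/2 - 3 * \<eta>)) \<le> 1 / ((real n - 1) * (1/4))"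
        using elim(6) \<eta> by (intro divide_left_mono mult_left_mono mult_pos_pos) auto
      hence s: "1 / ((real n - 1) * (1/2 - 3 * \<eta>)) \<le> s n / real n" using elim(3) by linarith
      show ?case
        using sigma1_probability[of c0 \<eta> "K n" "s n" \<epsilon> "M n (L n) (Ks n) (Kr n)"]
          elim A2 \<eta> s eps H0[of n]
        by (simp add: Let_def K_def s_def a_def F_def ps_def pr_def)
    qed
  qed (auto simp: measure_pmf.prob_le_1)
qed

end
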